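(* There is a polynomial-time algorithm that, given a graph $G$ together with a rooted layout of $G$ of mim-width at most $1$, solves \textsc{Induced Cluster Subgraph} on $G$, i.e., finds a maximum-size set $S\subseteq V(G)$ such that $G[S]$ is a cluster graph.
   Context: A cluster graph is a graph whose every connected component is a complete graph. For $A\subseteq V(G)$, $\mathrm{mim}_G(A)$ is the maximum size of an induced matching among the edges of $G$ between $A$ and $V(G)\setminus A$. A rooted layout of $G$ is a pair $(T,L)$ where $T$ is a rooted full binary tree (each node has zero or two children) with $|V(G)|$ leaves and $L$ is a bijection from $V(G)$ to the leaves of $T$. Each edge $e$ of $T$ splits the leaves into two parts and hence $V(G)$ into $(A^e_1,A^e_2)$; the mim-width of $(T,L)$ is $\max_{e\in E(T)}\mathrm{mim}_G(A^e_1)$. *)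

theory Defs
  imports Complex_Main "HOL-Computational_Algebra.Polynomial"
begin

section \<open>Graphs\<close>

text \<open>Simple undirected graphs: edges are two-element sets of vertices.\<close>

type_synonym 'a graph = "'a set \<times> 'a set set"

abbreviation verts :: "'a graph \<Rightarrow> 'a set" where "verts G \<equiv> fst G"
abbreviation edges :: "'a graph \<Rightarrow> 'a set set" where "edges G \<equiv> snd G"

definition simple_graph :: "'a graph \<Rightarrow> bool" where
  "simple_graph G \<longleftrightarrow> finite (verts G) \<and>
     edges G \<subseteq> {{u, v} | u v. u \<in> verts G \<and> v \<in> verts G \<and> u \<noteq> v}"

definition induced_subgraph :: "'a graph \<Rightarrow> 'a set \<Rightarrow> 'a graph" where
  "induced_subgraph G S = (S, {e \<in> edges G. e \<subseteq> S})"

definition complete_graph :: "'a graph \<Rightarrow> bool" where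
  "complete_graph G \<longleftrightarrow> (\<forall>u\<in>verts G. \<forall>v\<in>verts G. u \<noteq> v \<longrightarrow> {u, v} \<in> edges G)"

definition connected_components :: "'a graph \<Rightarrow> 'a set set" where
  "connected_components G =
     (\<lambda>u. {v \<in> verts G. (u, v) \<in> {(x, y). {x, y} \<in> edges G}\<^sup>*}) ` verts G"

definition cluster_graph :: "'a graph \<Rightarrow> bool" where
  "cluster_graph G \<longleftrightarrow>
     (\<forall>C \<in> connected_components G. complete_graph (induced_subgraph G C))"

definition max_induced_cluster :: "'a graph \<Rightarrow> 'a set \<Rightarrow> bool" where
  "max_induced_cluster G S \<longleftrightarrow>
     S \<subseteq> verts G \<and> cluster_graph (induced_subgraph G S) \<and>
     (\<forall>S'. S' \<subseteq> verts G \<and> cluster_graph (induced_subgraph G S') \<longrightarrow> card S' \<le> card S)"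

section \<open>Rooted layouts and mim-width\<close>

text \<open>The bipartite graph of the edges crossing the cut \<open>(A, V(G) - A)\<close>. Matchings are
  induced with respect to this graph: edges of \<open>G\<close> inside a side of the cut do not count.\<close>

definition cut_graph :: "'a graph \<Rightarrow> 'a set \<Rightarrow> 'a graph" where
  "cut_graph G A = (verts G, {e \<in> edges G. e \<inter> A \<noteq> {} \<and> e \<inter> (verts G - A) \<noteq> {}})"

definition induced_matching :: "'a graph \<Rightarrow> 'a set set \<Rightarrow> bool" where
  "induced_matching H M \<longleftrightarrow> M \<subseteq> edges H \<and> (\<forall>e\<in>M. \<forall>f\<in>M. e \<noteq> f \<longrightarrow> e \<inter> f = {}) \<and>
     edges (induced_subgraph H (\<Union>M)) = M"

definition mim :: "'a graph \<Rightarrow> 'a set \<Rightarrow> nat" where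
  "mim G A = Max (card ` {M. induced_matching (cut_graph G A) M})"

text \<open>A rooted full binary tree whose leaves carry labels; a layout \<open>(T, L)\<close> is the tree
  \<open>T\<close> in which the leaf \<open>L v\<close> is labelled \<open>v\<close>. That \<open>L\<close> is a bijection means that every
  vertex labels exactly one leaf.\<close>

datatype 'a layout = Leaf 'a | Node "'a layout" "'a layout"

fun leaves :: "'a layout \<Rightarrow> 'a list" where
  "leaves (Leaf v) = [v]"
| "leaves (Node l r) = leaves l @ leaves r"

definition rooted_layout :: "'a graph \<Rightarrow> 'a layout \<Rightarrow> bool" where
  "rooted_layout G T \<longleftrightarrow> distinct (leaves T) \<and> set (leaves T) = verts G"

text \<open>For every tree edge, the side of its cut that lies below the edge.\<close>

fun edge_cuts :: "'a layout \<Rightarrow> 'a set set" where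
  "edge_cuts (Leaf v) = {}"
| "edge_cuts (Node l r) = {set (leaves l), set (leaves r)} \<union> edge_cuts l \<union> edge_cuts r"

text \<open>The inserted \<open>0\<close> only matters for the one-leaf tree, which has no edges.\<close>

definition mim_width :: "'a graph \<Rightarrow> 'a layout \<Rightarrow> nat" where
  "mim_width G T = Max (insert 0 (mim G ` edge_cuts T))"

section \<open>Algorithms and running time\<close>

text \<open>Algorithms are programs of a first-order call-by-value language over binary trees of
  cells with natural numbers at the tips. The running time is the number of
  evaluation steps. Each step does one unit of work of a unit-cost RAM with
  addition and subtraction but no multiplication: cells are pointers, so building and
  projecting a pair takes constant time, and comparisons are restricted to numbers.
  After \<open>t\<close> steps there are at most \<open>t\<close> new cells and all numbers have at most
  \<open>t\<close> more bits than those of the input and program, so the model is polynomially equivalent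
  to Turing machines.\<close>

datatype val = Num nat | Cell val val

datatype prim = Plus | Minus | Lt | Eq | Mk | Fst | Snd | IsCell

fun apply_prim :: "prim \<Rightarrow> val list \<Rightarrow> val option" where
  "apply_prim Plus vs = (case vs of [Num a, Num b] \<Rightarrow> Some (Num (a + b)) | _ \<Rightarrow> None)"
| "apply_prim Minus vs = (case vs of [Num a, Num b] \<Rightarrow> Some (Num (a - b)) | _ \<Rightarrow> None)"
| "apply_prim Lt vs =
     (case vs of [Num a, Num b] \<Rightarrow> Some (Num (if a < b then 1 else 0)) | _ \<Rightarrow> None)"
| "apply_prim Eq vs =
     (case vs of [Num a, Num b] \<Rightarrow> Some (Num (if a = b then 1 else 0)) | _ \<Rightarrow> None)"
| "apply_prim Mk vs = (case vs of [v, w] \<Rightarrow> Some (Cell v w) | _ \<Rightarrow> None)"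
| "apply_prim Fst vs = (case vs of [Cell v w] \<Rightarrow> Some v | _ \<Rightarrow> None)"
| "apply_prim Snd vs = (case vs of [Cell v w] \<Rightarrow> Some w | _ \<Rightarrow> None)"
| "apply_prim IsCell vs =
     (case vs of [Cell v w] \<Rightarrow> Some (Num 1) | [Num a] \<Rightarrow> Some (Num 0) | _ \<Rightarrow> None)"

text \<open>\<open>Var i\<close> is the \<open>i\<close>-th entry of the environment, \<open>LetIn a e\<close> evaluates \<open>e\<close> with the value
  of \<open>a\<close> put in front of the environment, and \<open>Call f es\<close> evaluates the \<open>f\<close>-th function body
  of the program with the values of \<open>es\<close> as its environment.\<close>

datatype expr =
    Var nat
  | Const nat
  | Prim prim "expr list"
  | Cond expr expr expr
  | LetIn expr expr
  | Call nat "expr list"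

type_synonym program = "expr list"

text \<open>\<open>eval P env e v t\<close>: the expression \<open>e\<close> evaluates to \<open>v\<close> in exactly \<open>t\<close> steps.
  Ill-typed and non-terminating evaluations have no derivation.\<close>

inductive eval :: "program \<Rightarrow> val list \<Rightarrow> expr \<Rightarrow> val \<Rightarrow> nat \<Rightarrow> bool"
  and evals :: "program \<Rightarrow> val list \<Rightarrow> expr list \<Rightarrow> val list \<Rightarrow> nat \<Rightarrow> bool"
  for P :: program
where
  eval_Var: "i < length env \<Longrightarrow> eval P env (Var i) (env ! i) 1"
| eval_Const: "eval P env (Const n) (Num n) 1"
| eval_Prim: "evals P env es vs t \<Longrightarrow> apply_prim f vs = Some v \<Longrightarrow>
    eval P env (Prim f es) v (t + 1)"
| eval_Cond: "eval P env c (Num k) t1 \<Longrightarrow> eval P env (if k \<noteq> 0 then a else b) v t2 \<Longrightarrow>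
    eval P env (Cond c a b) v (t1 + t2 + 1)"
| eval_LetIn: "eval P env a w t1 \<Longrightarrow> eval P (w # env) e v t2 \<Longrightarrow>
    eval P env (LetIn a e) v (t1 + t2 + 1)"
| eval_Call: "evals P env es vs t1 \<Longrightarrow> f < length P \<Longrightarrow> eval P vs (P ! f) v t2 \<Longrightarrow>
    eval P env (Call f es) v (t1 + t2 + 1)"
| evals_Nil: "evals P env [] [] 0"
| evals_Cons: "eval P env e v t1 \<Longrightarrow> evals P env es vs t2 \<Longrightarrow>
    evals P env (e # es) (v # vs) (t1 + t2)"

inductive_cases eval_VarE: "eval P env (Var i) v t"
inductive_cases eval_ConstE: "eval P env (Const n) v t"
inductive_cases eval_PrimE: "eval P env (Prim f es) v t"
inductive_cases eval_CondE: "eval P env (Cond c a b) v t"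
inductive_cases eval_LetInE: "eval P env (LetIn a e) v t"
inductive_cases eval_CallE: "eval P env (Call f es) v t"
inductive_cases evals_NilE: "evals P env [] vs t"
inductive_cases evals_ConsE: "evals P env (e # es) vs t"

lemma eval_deterministic:
  "eval P env e v t \<Longrightarrow> eval P env e v' t' \<Longrightarrow> v' = v \<and> t' = t"
  "evals P env es vs t \<Longrightarrow> evals P env es vs' t' \<Longrightarrow> vs' = vs \<and> t' = t"
proof (induction arbitrary: v' t' and vs' t' rule: eval_evals.inducts)
  case (eval_Var i env) then show ?case by (auto elim: eval_VarE)
next
  case (eval_Const env n) then show ?case by (auto elim: eval_ConstE)
next
  case (eval_Prim env es vs t f v)
  from eval_Prim.prems obtain vs2 t2
    where "t' = t2 + 1" and "evals P env es vs2 t2" and "apply_prim f vs2 = Some v'"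
    by (rule eval_PrimE) simp
  moreover from this eval_Prim.IH(2) have "vs2 = vs \<and> t2 = t" by simp
  ultimately show ?case using eval_Prim.hyps by simp
next
  case (eval_Cond env c k t1 a b v t2)
  from eval_Cond.prems obtain k' s1 s2
    where *: "t' = s1 + s2 + 1" "eval P env c (Num k') s1"
      "eval P env (if k' \<noteq> 0 then a else b) v' s2"
    by (rule eval_CondE) simp
  from eval_Cond.IH(2)[OF *(2)] have "k' = k" "s1 = t1" by simp_all
  with eval_Cond.IH(4)[of v' s2] * show ?case by simp
next
  case (eval_LetIn env a w t1 e v t2)
  from eval_LetIn.prems obtain w' s1 s2
    where *: "t' = s1 + s2 + 1" "eval P env a w' s1" "eval P (w' # env) e v' s2"
    by (rule eval_LetInE) simp
  from eval_LetIn.IH(2)[OF *(2)] eval_LetIn.IH(4)[of v' s2] * show ?case by simp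
next
  case (eval_Call env es vs t1 f v t2)
  from eval_Call.prems obtain vs2 s1 s2
    where *: "t' = s1 + s2 + 1" "evals P env es vs2 s1" "eval P vs2 (P ! f) v' s2"
    by (rule eval_CallE) simp
  from eval_Call.IH(2)[OF *(2)] eval_Call.IH(5)[of v' s2] * show ?case by simp
next
  case (evals_Nil env) then show ?case by (auto elim: evals_NilE)
next
  case (evals_Cons env e v t1 es vs t2)
  from evals_Cons.prems obtain v2 vs2 s1 s2
    where *: "vs' = v2 # vs2" "t' = s1 + s2" "eval P env e v2 s1" "evals P env es vs2 s2"
    by (rule evals_ConsE) simp
  from evals_Cons.IH(2)[OF *(3)] evals_Cons.IH(4)[OF *(4)] * show ?case by simp
qed

text \<open>A program solves a search problem in polynomial time if, on every instance, its function
  \<open>0\<close> applied to the encoded instance returns a solution within a number of steps that is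
  polynomial in the size of the instance.\<close>

definition solves_in_poly_time ::
  "program \<Rightarrow> 'i set \<Rightarrow> ('i \<Rightarrow> val) \<Rightarrow> ('i \<Rightarrow> nat) \<Rightarrow> ('i \<Rightarrow> val \<Rightarrow> bool) \<Rightarrow> bool"
where
  "solves_in_poly_time P instances enc sz solution \<longleftrightarrow>
     (\<exists>p :: nat poly. \<forall>x \<in> instances. \<exists>y t.
        eval P [enc x] (Call 0 [Var 0]) y t \<and> t \<le> poly p (sz x) \<and> solution x y)"

section \<open>Encodings\<close>

fun enc_list :: "val list \<Rightarrow> val" where
  "enc_list [] = Num 0"
| "enc_list (x # xs) = Cell x (enc_list xs)"

text \<open>The adjacency matrix of a graph with vertex set \<open>{..<n}\<close>, as a list of rows.\<close>

definition enc_graph :: "nat graph \<Rightarrow> val" where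
  "enc_graph G = (let n = card (verts G) in
     enc_list (map (\<lambda>i. enc_list (map (\<lambda>j. Num (if {i, j} \<in> edges G then 1 else 0)) [0..<n])) [0..<n]))"

fun enc_layout :: "nat layout \<Rightarrow> val" where
  "enc_layout (Leaf v) = Num v"
| "enc_layout (Node l r) = Cell (enc_layout l) (enc_layout r)"

text \<open>As usual for inputs of algorithms, the vertices are numbered from \<open>0\<close>. The length of the
  encoding is polynomial in the number of vertices and vice versa, so the latter serves as
  the size of an instance.\<close>

definition mimw1_instances :: "(nat graph \<times> nat layout) set" where
  "mimw1_instances = {(G, T). simple_graph G \<and> verts G = {..<card (verts G)} \<and>
     rooted_layout G T \<and> mim_width G T \<le> 1}"

definition enc_instance :: "nat graph \<times> nat layout \<Rightarrow> val" where
  "enc_instance = (\<lambda>(G, T). Cell (enc_graph G) (enc_layout T))"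

definition encodes_vertex_set :: "val \<Rightarrow> nat set \<Rightarrow> bool" where
  "encodes_vertex_set y S \<longleftrightarrow> (\<exists>xs. distinct xs \<and> set xs = S \<and> y = enc_list (map Num xs))"

end

theory Submission imports Defs begin

text \<open>A cut of mim-value at most \<open>1\<close> is a chain graph: the neighbourhoods across it are linearly
  ordered by inclusion. Hence at most one clique of an induced cluster graph has edges across the
  cut. Split a partial solution on one side into a clique \<open>C\<close> that may still grow across the cut
  and the rest \<open>R\<close>, which may not have neighbours there. Its interaction with the other side is
  determined by three sets of vertices of that side: those with a neighbour in \<open>R\<close>, those with a
  neighbour in \<open>C\<close>, and those adjacent to all of \<open>C\<close>. Each of the three ranges over a chain, so
  its cardinality identifies it. A dynamic program over the layout that keeps one largest partial
  solution for every triple of cardinalities is therefore exact, and its tables have at most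
  \<open>(n + 1)\<^sup>3\<close> entries.\<close>

section \<open>Chain cuts\<close>

text \<open>The obstacle is that the entry a child table offers is in general not the restriction of
  an optimal \<open>S\<close>, and the entries of the two children are not chosen to fit each other.
  Combining them still works because edges between two parts are only ever tested for being all
  absent or all present. Either answer survives replacing the part on one side, and then the part on
  the other, as long as the replacement has the same neighbours, or the same common neighbours,
  across its cut. So completeness compares an entry with \<open>S\<close> only through what is
  visible across the cut, never vertex by vertex. The clique carries two neighbourhoods because it
  may be asked both questions; the rest is asked only for absence of edges. The same tables govern
  the running time: distinct keys bound their length throughout, and validity of the entries bounds
  the vertex lists, so parts of the correctness argument return as loop invariants of the
  program.\<close>

definition some_nbrs :: "('a \<Rightarrow> 'a \<Rightarrow> bool) \<Rightarrow> 'a set \<Rightarrow> 'a set \<Rightarrow> 'a set" where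
  "some_nbrs adj Y X = {y \<in> Y. \<exists>x\<in>X. adj x y}"

definition all_nbrs :: "('a \<Rightarrow> 'a \<Rightarrow> bool) \<Rightarrow> 'a set \<Rightarrow> 'a set \<Rightarrow> 'a set" where
  "all_nbrs adj Y X = {y \<in> Y. \<forall>x\<in>X. adj x y}"

definition p3_free :: "('a \<Rightarrow> 'a \<Rightarrow> bool) \<Rightarrow> 'a set \<Rightarrow> bool" where
  "p3_free adj S \<longleftrightarrow> (\<forall>u\<in>S. \<forall>v\<in>S. \<forall>w\<in>S. adj u v \<longrightarrow> adj v w \<longrightarrow> u \<noteq> w \<longrightarrow> adj u w)"

definition clique :: "('a \<Rightarrow> 'a \<Rightarrow> bool) \<Rightarrow> 'a set \<Rightarrow> bool" where
  "clique adj C \<longleftrightarrow> (\<forall>u\<in>C. \<forall>v\<in>C. u \<noteq> v \<longrightarrow> adj u v)"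

definition chain_cut :: "('a \<Rightarrow> 'a \<Rightarrow> bool) \<Rightarrow> 'a set \<Rightarrow> 'a set \<Rightarrow> bool" where
  "chain_cut adj A Y \<longleftrightarrow> (\<forall>u\<in>A. \<forall>v\<in>A.
     some_nbrs adj Y {u} \<subseteq> some_nbrs adj Y {v} \<or> some_nbrs adj Y {v} \<subseteq> some_nbrs adj Y {u})"

lemma chain_cutD:
  assumes "chain_cut adj A Y" "u \<in> A" "v \<in> A"
  shows "(\<forall>y\<in>Y. adj u y \<longrightarrow> adj v y) \<or> (\<forall>y\<in>Y. adj v y \<longrightarrow> adj u y)"
  using assms unfolding chain_cut_def some_nbrs_def by blast

text \<open>If \<open>x'\<close> in \<open>X'\<close> sees some \<open>y\<close> that no vertex of
  \<open>X\<close> sees, nesting can only go one way: \<open>x'\<close> sees everything any vertex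
  of \<open>X\<close> sees. For common neighbourhoods the dual choice works, a vertex of
  \<open>X\<close> that misses a common neighbour of \<open>X'\<close>.\<close>

lemma some_nbrs_comparable:
  assumes "chain_cut adj A Y" "X \<subseteq> A" "X' \<subseteq> A"
  shows "some_nbrs adj Y X \<subseteq> some_nbrs adj Y X' \<or> some_nbrs adj Y X' \<subseteq> some_nbrs adj Y X"
proof (rule disjCI)
  assume "\<not> some_nbrs adj Y X' \<subseteq> some_nbrs adj Y X"
  then obtain x' y where x': "x' \<in> X'" "y \<in> Y" "adj x' y" "\<forall>x\<in>X. \<not> adj x y"
    by (auto simp: some_nbrs_def)
  have "\<forall>y\<in>Y. adj x y \<longrightarrow> adj x' y" if "x \<in> X" for x
    using chain_cutD[OF assms(1), of x x'] x' that assms(2,3) by blast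
  then show "some_nbrs adj Y X \<subseteq> some_nbrs adj Y X'" using x'(1) by (auto simp: some_nbrs_def)
qed

lemma all_nbrs_comparable:
  assumes "chain_cut adj A Y" "X \<subseteq> A" "X' \<subseteq> A"
  shows "all_nbrs adj Y X \<subseteq> all_nbrs adj Y X' \<or> all_nbrs adj Y X' \<subseteq> all_nbrs adj Y X"
proof (rule disjCI)
  assume "\<not> all_nbrs adj Y X' \<subseteq> all_nbrs adj Y X"
  then obtain x y where x: "x \<in> X" "y \<in> Y" "\<not> adj x y" "\<forall>x'\<in>X'. adj x' y"
    by (auto simp: all_nbrs_def)
  have "\<forall>y\<in>Y. adj x y \<longrightarrow> adj x' y" if "x' \<in> X'" for x'
    using chain_cutD[OF assms(1), of x x'] x that assms(2,3) by blast
  then show "all_nbrs adj Y X \<subseteq> all_nbrs adj Y X'" using x(1) by (auto simp: all_nbrs_def)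
qed

lemma some_nbrs_eq_of_card:
  assumes "chain_cut adj A Y" "X \<subseteq> A" "X' \<subseteq> A" "finite Y"
    "card (some_nbrs adj Y X) = card (some_nbrs adj Y X')"
  shows "some_nbrs adj Y X = some_nbrs adj Y X'"
proof -
  have "finite (some_nbrs adj Y Z)" for Z using assms(4) by (simp add: some_nbrs_def)
  then show ?thesis using some_nbrs_comparable[OF assms(1-3)] assms(5) by (metis card_subset_eq)
qed

lemma all_nbrs_eq_of_card:
  assumes "chain_cut adj A Y" "X \<subseteq> A" "X' \<subseteq> A" "finite Y"
    "card (all_nbrs adj Y X) = card (all_nbrs adj Y X')"
  shows "all_nbrs adj Y X = all_nbrs adj Y X'"
proof -
  have "finite (all_nbrs adj Y Z)" for Z using assms(4) by (simp add: all_nbrs_def)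
  then show ?thesis using all_nbrs_comparable[OF assms(1-3)] assms(5) by (metis card_subset_eq)
qed

definition count_any :: "('a \<Rightarrow> 'a \<Rightarrow> bool) \<Rightarrow> 'a list \<Rightarrow> 'a list \<Rightarrow> nat" where
  "count_any adj X Y = length (filter (\<lambda>y. \<exists>x\<in>set X. adj x y) Y)"

definition count_all :: "('a \<Rightarrow> 'a \<Rightarrow> bool) \<Rightarrow> 'a list \<Rightarrow> 'a list \<Rightarrow> nat" where
  "count_all adj X Y = length (filter (\<lambda>y. \<forall>x\<in>set X. adj x y) Y)"

lemma count_any_card: "distinct Y \<Longrightarrow> count_any adj X Y = card (some_nbrs adj (set Y) (set X))"
  by (simp add: count_any_def some_nbrs_def distinct_card[symmetric])

lemma count_all_card: "distinct Y \<Longrightarrow> count_all adj X Y = card (all_nbrs adj (set Y) (set X))"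
  by (simp add: count_all_def all_nbrs_def distinct_card[symmetric])

lemma count_any_eq_0: "count_any adj X Y = 0 \<longleftrightarrow> (\<forall>x\<in>set X. \<forall>y\<in>set Y. \<not> adj x y)"
  unfolding count_any_def by (auto simp: filter_empty_conv)

lemma count_all_eq_length:
  "count_all adj X Y = length Y \<longleftrightarrow> (\<forall>x\<in>set X. \<forall>y\<in>set Y. adj x y)"
proof -
  have "length (filter P Y) = length Y \<longleftrightarrow> (\<forall>y\<in>set Y. P y)" for P :: "'a \<Rightarrow> bool"
    by (metis filter_id_conv length_filter_less less_irrefl)
  then show ?thesis by (auto simp: count_all_def)
qed

section \<open>The dynamic program\<close>

text \<open>An entry \<open>(C, R)\<close> is a partial solution with growing clique \<open>C\<close> and remaining vertices \<open>R\<close>.\<close>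

type_synonym 'a entry = "'a list \<times> 'a list"

fun key :: "('a \<Rightarrow> 'a \<Rightarrow> bool) \<Rightarrow> 'a list \<Rightarrow> 'a entry \<Rightarrow> nat \<times> nat \<times> nat" where
  "key adj out (C, R) = (count_any adj R out, count_any adj C out, count_all adj C out)"

fun entry_size :: "'a entry \<Rightarrow> nat" where
  "entry_size (C, R) = length C + length R"

text \<open>The head of the table under construction is the entry being inserted; an old entry with the
  same key competes with it for that place.\<close>

fun insert_step :: "('a entry \<Rightarrow> 'k) \<Rightarrow> 'a entry \<Rightarrow> 'a entry list \<Rightarrow> 'a entry list" where
  "insert_step k f (b # tbl) =
     (if k f = k b then (if entry_size b < entry_size f then f else b) # tbl else b # f # tbl)"
| "insert_step k f [] = []"

definition insert_best :: "('a entry \<Rightarrow> 'k) \<Rightarrow> 'a entry \<Rightarrow> 'a entry list \<Rightarrow> 'a entry list" where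
  "insert_best k e tbl = fold (insert_step k) tbl [e]"

text \<open>Loop invariant of the insertion. Only the head \<open>b\<close> may still meet an entry
  of \<open>fs\<close> with its own key; what has moved behind the head is settled, so the third
  assumption speaks of \<open>tbl\<close> without \<open>b\<close>.\<close>

lemma fold_insert_step:
  assumes "distinct (map k (b # tbl))" "distinct (map k fs)"
    "\<forall>f\<in>set fs. k f \<notin> k ` set tbl"
  shows "let res = fold (insert_step k) fs (b # tbl) in
    distinct (map k res) \<and> set res \<subseteq> set (b # tbl) \<union> set fs \<and>
    (\<forall>e \<in> set (b # tbl) \<union> set fs. \<exists>e' \<in> set res. k e' = k e \<and> entry_size e \<le> entry_size e')"
  using assms
proof (induction fs arbitrary: b tbl)
  case Nil
  then show ?case by auto
next
  case (Cons f fs)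
  show ?case
  proof (cases "k f = k b")
    case True
    define b' where "b' = (if entry_size b < entry_size f then f else b)"
    have b': "k b' = k b" "b' \<in> {f, b}" "entry_size b \<le> entry_size b'" "entry_size f \<le> entry_size b'"
      using True by (auto simp: b'_def)
    have "let res = fold (insert_step k) fs (b' # tbl) in
      distinct (map k res) \<and> set res \<subseteq> set (b' # tbl) \<union> set fs \<and>
      (\<forall>e \<in> set (b' # tbl) \<union> set fs. \<exists>e' \<in> set res. k e' = k e \<and> entry_size e \<le> entry_size e')"
      using Cons.prems b' by (intro Cons.IH) auto
    moreover have "fold (insert_step k) (f # fs) (b # tbl) = fold (insert_step k) fs (b' # tbl)"
      using True by (simp add: b'_def)
    ultimately show ?thesis using b' True
      by (auto simp: Let_def)
  next
    case False
    have nf: "k f' \<noteq> k f" if "f' \<in> set fs" for f'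
      using Cons.prems(2) that by (auto simp: rev_image_eqI)
    have "let res = fold (insert_step k) fs (b # f # tbl) in
      distinct (map k res) \<and> set res \<subseteq> set (b # f # tbl) \<union> set fs \<and>
      (\<forall>e \<in> set (b # f # tbl) \<union> set fs. \<exists>e' \<in> set res. k e' = k e \<and> entry_size e \<le> entry_size e')"
      using Cons.prems False nf by (intro Cons.IH) simp_all
    then show ?thesis using False by (auto simp: Let_def)
  qed
qed

lemma insert_best_correct:
  assumes "distinct (map k tbl)"
  shows "distinct (map k (insert_best k e tbl))" "set (insert_best k e tbl) \<subseteq> insert e (set tbl)"
    "\<forall>f \<in> insert e (set tbl). \<exists>f' \<in> set (insert_best k e tbl). k f' = k f \<and> entry_size f \<le> entry_size f'"
  using fold_insert_step[of k e "[]" tbl] assms by (auto simp: insert_best_def Let_def)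

text \<open>An entry may be displaced several times, but always by one with the same key and at
  least its size, so domination passes through the fold by transitivity.\<close>

lemma fold_insert_best_correct:
  assumes "distinct (map k tbl)"
  shows "distinct (map k (fold (insert_best k) es tbl))"
    "set (fold (insert_best k) es tbl) \<subseteq> set es \<union> set tbl"
    "\<forall>f \<in> set es \<union> set tbl. \<exists>f' \<in> set (fold (insert_best k) es tbl). k f' = k f \<and> entry_size f \<le> entry_size f'"
proof -
  have "distinct (map k (fold (insert_best k) es tbl)) \<and>
    set (fold (insert_best k) es tbl) \<subseteq> set es \<union> set tbl \<and>
    (\<forall>f \<in> set es \<union> set tbl. \<exists>f' \<in> set (fold (insert_best k) es tbl). k f' = k f \<and> entry_size f \<le> entry_size f')"
    using assms
  proof (induction es arbitrary: tbl)
    case Nil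
    then show ?case by auto
  next
    case (Cons e es)
    note i = insert_best_correct[OF Cons.prems, of e]
    note h = Cons.IH[OF i(1)]
    have "\<exists>f' \<in> set (fold (insert_best k) (e # es) tbl). k f' = k f \<and> entry_size f \<le> entry_size f'"
      if f: "f \<in> set (e # es) \<union> set tbl" for f
    proof (cases "f \<in> set es")
      case True
      then show ?thesis using h by simp
    next
      case False
      then obtain g where "g \<in> set (insert_best k e tbl)" "k g = k f" "entry_size f \<le> entry_size g"
        using f i(3) by auto
      then show ?thesis using h by simp (metis UnI2 order.trans)
    qed
    then show ?case using h i(2) by auto
  qed
  then show "distinct (map k (fold (insert_best k) es tbl))"
    "set (fold (insert_best k) es tbl) \<subseteq> set es \<union> set tbl"
    "\<forall>f \<in> set es \<union> set tbl. \<exists>f' \<in> set (fold (insert_best k) es tbl). k f' = k f \<and> entry_size f \<le> entry_size f'"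
    by blast+
qed

text \<open>Two growing cliques either merge or stay apart. A merged clique goes on growing or
  retires into the rest; of two separate cliques at most one goes on, since only one clique can
  cross the next cut. Both tests succeed when \<open>C1\<close> or \<open>C2\<close> is empty, hence
  the append instead of an alternative. The \<open>rev\<close> mirrors the accumulating append of
  the program, so that its tables agree literally with these.\<close>

fun candidates :: "('a \<Rightarrow> 'a \<Rightarrow> bool) \<Rightarrow> 'a entry \<Rightarrow> 'a entry \<Rightarrow> 'a entry list" where
  "candidates adj (C1, R1) (C2, R2) =
    (if count_any adj R1 C2 + count_any adj R1 R2 + count_any adj C1 R2 = 0 then
      (let R = rev R1 @ R2; C = rev C1 @ C2 in
      (if count_all adj C1 C2 = length C2 then [([], rev C @ R), (C, R)] else []) @
      (if count_any adj C1 C2 = 0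
       then [([], rev C @ R), (C1, rev C2 @ R), (C2, rev C1 @ R)] else []))
     else [])"

definition combine ::
  "('a \<Rightarrow> 'a \<Rightarrow> bool) \<Rightarrow> 'a list \<Rightarrow> 'a entry list \<Rightarrow> 'a entry list \<Rightarrow> 'a entry list" where
  "combine adj out T1 T2 =
     fold (\<lambda>e1. fold (\<lambda>e2. fold (insert_best (key adj out)) (candidates adj e1 e2)) T2) T1 []"

text \<open>The order at a leaf matters for the one-leaf layout, where the first entry is the answer.\<close>

fun solve :: "('a \<Rightarrow> 'a \<Rightarrow> bool) \<Rightarrow> 'a layout \<Rightarrow> 'a list \<Rightarrow> 'a entry list" where
  "solve adj (Leaf v) out = [([v], []), ([], [v]), ([], [])]"
| "solve adj (Node l r) out =
     combine adj out (solve adj l (leaves r @ out)) (solve adj r (leaves l @ out))"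

lemma fold_fold: "fold (\<lambda>x. fold f (g x)) xs a = fold f (concat (map g xs)) a"
  by (induction xs arbitrary: a) auto

lemma combine_eq:
  "combine adj out T1 T2 =
     fold (insert_best (key adj out)) (concat (map (\<lambda>e1. concat (map (candidates adj e1) T2)) T1)) []"
proof -
  have "(\<lambda>e1. fold (\<lambda>e2. fold (insert_best (key adj out)) (candidates adj e1 e2)) T2) =
    (\<lambda>e1. fold (insert_best (key adj out)) (concat (map (candidates adj e1) T2)))"
    by (rule ext, rule ext, rule fold_fold)
  then show ?thesis by (simp only: combine_def fold_fold)
qed

lemma combine_correct:
  shows "distinct (map (key adj out) (combine adj out T1 T2))"
    "e \<in> set (combine adj out T1 T2) \<Longrightarrow> \<exists>e1\<in>set T1. \<exists>e2\<in>set T2. e \<in> set (candidates adj e1 e2)"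
    "e1 \<in> set T1 \<Longrightarrow> e2 \<in> set T2 \<Longrightarrow> e \<in> set (candidates adj e1 e2) \<Longrightarrow>
      \<exists>e' \<in> set (combine adj out T1 T2). key adj out e' = key adj out e \<and> entry_size e \<le> entry_size e'"
proof -
  define es where "es = concat (map (\<lambda>e1. concat (map (candidates adj e1) T2)) T1)"
  have es: "f \<in> set es \<longleftrightarrow> (\<exists>e1\<in>set T1. \<exists>e2\<in>set T2. f \<in> set (candidates adj e1 e2))" for f
    unfolding es_def by (simp del: candidates.simps)
  note c = combine_eq[of adj out T1 T2, folded es_def]
  note f = fold_insert_best_correct[of "key adj out" "[]" es, folded c]
  show "distinct (map (key adj out) (combine adj out T1 T2))" using f(1) by simp
  show "\<exists>e1\<in>set T1. \<exists>e2\<in>set T2. e \<in> set (candidates adj e1 e2)" if "e \<in> set (combine adj out T1 T2)"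
    using that f(2) es[of e] by auto
  show "\<exists>e' \<in> set (combine adj out T1 T2). key adj out e' = key adj out e \<and> entry_size e \<le> entry_size e'"
    if "e1 \<in> set T1" "e2 \<in> set T2" "e \<in> set (candidates adj e1 e2)"
    using that es[of e] f(3)[simplified] by blast
qed

section \<open>Soundness: every table entry induces a cluster graph\<close>

text \<open>Nothing is demanded outside \<open>A\<close>: whether \<open>C\<close> may grow and
  \<open>R\<close> stays separated is tested only when two entries meet.\<close>

fun valid :: "('a \<Rightarrow> 'a \<Rightarrow> bool) \<Rightarrow> 'a set \<Rightarrow> 'a entry \<Rightarrow> bool" where
  "valid adj A (C, R) \<longleftrightarrow> distinct (C @ R) \<and> set C \<union> set R \<subseteq> A \<and> clique adj (set C) \<and>
     p3_free adj (set R) \<and> (\<forall>x\<in>set C. \<forall>y\<in>set R. \<not> adj x y)"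

text \<open>A violating path is connected, so with no edges between the parts it lies within one of
  them.\<close>

lemma p3_free_Un:
  assumes "symp adj" "p3_free adj X" "p3_free adj Y" "\<forall>x\<in>X. \<forall>y\<in>Y. \<not> adj x y"
  shows "p3_free adj (X \<union> Y)"
proof -
  have "\<not> adj y x" if "x \<in> X" "y \<in> Y" for x y using assms(1,4) that by (auto dest: sympD)
  then show ?thesis using assms(2-4) unfolding p3_free_def by (metis Un_iff)
qed

lemma clique_p3_free: "clique adj C \<Longrightarrow> p3_free adj C"
  by (auto simp: clique_def p3_free_def)

lemma candidates_valid:
  assumes s: "symp adj" and v: "valid adj A e1" "valid adj B e2" and d: "A \<inter> B = {}"
    and e: "e \<in> set (candidates adj e1 e2)"
  shows "valid adj (A \<union> B) e"
proof -
  obtain C1 R1 C2 R2 where E: "e1 = (C1, R1)" "e2 = (C2, R2)" by (cases e1, cases e2)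
  have ok: "count_any adj R1 C2 + count_any adj R1 R2 + count_any adj C1 R2 = 0"
    using e E by (auto split: if_splits)
  have n: "\<forall>x\<in>set R1. \<forall>y\<in>set C2. \<not> adj x y" "\<forall>x\<in>set R1. \<forall>y\<in>set R2. \<not> adj x y"
    "\<forall>x\<in>set C1. \<forall>y\<in>set R2. \<not> adj x y" "\<forall>x\<in>set C1. \<forall>y\<in>set R1. \<not> adj x y"
    "\<forall>x\<in>set C2. \<forall>y\<in>set R2. \<not> adj x y"
    using ok v E by (auto simp: count_any_eq_0)
  have n': "\<forall>x\<in>set C2. \<forall>y\<in>set R1. \<not> adj x y" using n(1) s by (auto simp: symp_def)
  have ds: "distinct (C1 @ R1 @ C2 @ R2)" "set C1 \<union> set R1 \<subseteq> A" "set C2 \<union> set R2 \<subseteq> B"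
    using v E d by auto
  have c: "clique adj (set C1)" "clique adj (set C2)" using v E by auto
  have pR: "p3_free adj (set R1 \<union> set R2)"
    using v E n by (intro p3_free_Un[OF s]) auto
  consider (both) "\<forall>x\<in>set C1. \<forall>y\<in>set C2. adj x y"
      "e \<in> {([], rev (rev C1 @ C2) @ rev R1 @ R2), (rev C1 @ C2, rev R1 @ R2)}"
    | (none) "\<forall>x\<in>set C1. \<forall>y\<in>set C2. \<not> adj x y"
      "e \<in> {([], rev (rev C1 @ C2) @ rev R1 @ R2), (C1, rev C2 @ rev R1 @ R2), (C2, rev C1 @ rev R1 @ R2)}"
    using e E ok by (auto simp: Let_def count_any_eq_0 count_all_eq_length split: if_splits)
  then show ?thesis
  proof cases
    case both
    have cl: "clique adj (set C1 \<union> set C2)" using c both(1) s by (auto simp: clique_def symp_def)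
    have p: "p3_free adj ((set C1 \<union> set C2) \<union> (set R1 \<union> set R2))"
      using n n' by (intro p3_free_Un[OF s clique_p3_free[OF cl] pR]) auto
    have "set (rev (rev C1 @ C2) @ rev R1 @ R2) = (set C1 \<union> set C2) \<union> (set R1 \<union> set R2)" by auto
    then show ?thesis using both(2) cl p pR n n' ds by (auto simp: clique_def Un_ac)
  next
    case none
    have p12: "p3_free adj (set C1 \<union> set C2)"
      using none by (intro p3_free_Un[OF s] clique_p3_free c) auto
    have p: "p3_free adj ((set C1 \<union> set C2) \<union> (set R1 \<union> set R2))"
      using n n' by (intro p3_free_Un[OF s p12 pR]) auto
    have p1: "p3_free adj (set C1 \<union> (set R1 \<union> set R2))"
      using n by (intro p3_free_Un[OF s clique_p3_free[OF c(1)] pR]) auto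
    have p2: "p3_free adj (set C2 \<union> (set R1 \<union> set R2))"
      using n n' by (intro p3_free_Un[OF s clique_p3_free[OF c(2)] pR]) auto
    have n12: "\<forall>x\<in>set C2. \<forall>y\<in>set C1. \<not> adj x y" using none(1) s by (auto simp: symp_def)
    consider "e = ([], rev (rev C1 @ C2) @ rev R1 @ R2)" | "e = (C1, rev C2 @ rev R1 @ R2)"
      | "e = (C2, rev C1 @ rev R1 @ R2)" using none(2) by blast
    then show ?thesis
    proof cases
      case 1
      then show ?thesis using p ds by (auto simp: clique_def Un_ac)
    next
      case 2
      then show ?thesis using c p2 none(1) n ds by (auto simp: Un_ac)
    next
      case 3
      then show ?thesis using c p1 n12 n n' ds by (auto simp: Un_ac)
    qed
  qed
qed

lemma solve_valid:
  assumes "symp adj" "distinct (leaves t)" "e \<in> set (solve adj t out)"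
  shows "valid adj (set (leaves t)) e"
  using assms(2,3)
proof (induction t arbitrary: out e)
  case (Leaf v)
  then show ?case by (auto simp: clique_def p3_free_def)
next
  case (Node l r)
  then obtain e1 e2 where "e1 \<in> set (solve adj l (leaves r @ out))"
    "e2 \<in> set (solve adj r (leaves l @ out))" "e \<in> set (candidates adj e1 e2)"
    using combine_correct(2)[of e adj out] by (metis solve.simps(2))
  then show ?case
    using Node.IH(1)[of e1] Node.IH(2)[of e2] Node.prems(1)
      candidates_valid[OF assms(1), of "set (leaves l)" e1 "set (leaves r)" e2 e] by simp
qed

section \<open>Optimality\<close>

text \<open>The growing clique that \<open>S\<close> itself prescribes at the cut, empty if no
  clique of \<open>S\<close> crosses. It is the counterpart of \<open>C\<close> in an entry, and the
  remainder of \<open>S\<close> in \<open>A\<close> that of \<open>R\<close>.\<close>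

definition trace :: "('a \<Rightarrow> 'a \<Rightarrow> bool) \<Rightarrow> 'a set \<Rightarrow> 'a set \<Rightarrow> 'a set \<Rightarrow> 'a set" where
  "trace adj S A Y = {u \<in> S \<inter> A. \<exists>v \<in> S \<inter> Y. adj u v}"

fun represents :: "('a \<Rightarrow> 'a \<Rightarrow> bool) \<Rightarrow> 'a set \<Rightarrow> 'a set \<Rightarrow> 'a set \<Rightarrow> 'a entry \<Rightarrow> bool" where
  "represents adj S A Y (C, R) \<longleftrightarrow>
     some_nbrs adj Y (set C) = some_nbrs adj Y (trace adj S A Y) \<and>
     all_nbrs adj Y (set C) = all_nbrs adj Y (trace adj S A Y) \<and>
     some_nbrs adj Y (set R) = some_nbrs adj Y (S \<inter> A - trace adj S A Y) \<and>
     card (S \<inter> A) \<le> entry_size (C, R)"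

text \<open>The list \<open>out\<close> is meant to hold all vertices outside the subtree. The cuts
  above both children are listed at the node because the combination step argues with all three cuts
  around it, also when a child is a leaf.\<close>

fun chain_layout :: "('a \<Rightarrow> 'a \<Rightarrow> bool) \<Rightarrow> 'a layout \<Rightarrow> 'a list \<Rightarrow> bool" where
  "chain_layout adj (Leaf v) out \<longleftrightarrow> True"
| "chain_layout adj (Node l r) out \<longleftrightarrow>
     chain_cut adj (set (leaves l) \<union> set (leaves r)) (set out) \<and>
     chain_cut adj (set (leaves l)) (set (leaves r @ out)) \<and>
     chain_cut adj (set (leaves r)) (set (leaves l @ out)) \<and>
     chain_layout adj l (leaves r @ out) \<and> chain_layout adj r (leaves l @ out)"

text \<open>Of two trace vertices, the one with the larger neighbourhood also sees the witness of
  the other. The shared neighbour lies in \<open>S\<close>, and P3-freeness makes the two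
  adjacent.\<close>

lemma trace_clique:
  assumes "symp adj" "p3_free adj S" "chain_cut adj A Y"
  shows "clique adj (trace adj S A Y)"
  unfolding clique_def
proof (intro ballI impI)
  fix u v assume u: "u \<in> trace adj S A Y" and v: "v \<in> trace adj S A Y" and ne: "u \<noteq> v"
  obtain x y where xy: "x \<in> S \<inter> Y" "adj u x" "y \<in> S \<inter> Y" "adj v y"
    using u v by (auto simp: trace_def)
  have "u \<in> A" "v \<in> A" "u \<in> S" "v \<in> S" using u v by (auto simp: trace_def)
  then obtain z where "z \<in> S" "adj u z" "adj v z"
    using chain_cutD[OF assms(3), of u v] xy by blast
  then show "adj u v"
    using assms(2) sympD[OF assms(1)] ne \<open>u \<in> S\<close> \<open>v \<in> S\<close> unfolding p3_free_def by blast
qed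

text \<open>The exchange happens one side at a time: \<open>Z1\<close> becomes \<open>X1\<close>
  against the fixed \<open>Z2\<close>, then \<open>Z2\<close> becomes \<open>X2\<close> against the
  fixed \<open>X1\<close>. This is why the mixed inclusions \<open>Z2 \<subseteq> Y1\<close> and
  \<open>X1 \<subseteq> Y2\<close> are assumed. \<open>complete_transfer\<close> does the same with
  common neighbours.\<close>

lemma anti_transfer:
  assumes "symp adj" "some_nbrs adj Y1 X1 = some_nbrs adj Y1 Z1" "some_nbrs adj Y2 X2 = some_nbrs adj Y2 Z2"
    "X1 \<subseteq> Y2" "Z2 \<subseteq> Y1" "\<forall>x\<in>Z1. \<forall>y\<in>Z2. \<not> adj x y"
  shows "\<forall>x\<in>X1. \<forall>y\<in>X2. \<not> adj x y"
proof -
  have "\<forall>x\<in>X1. \<forall>y\<in>Z2. \<not> adj x y" using assms(2,5,6) by (auto simp: some_nbrs_def set_eq_iff)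
  then have "\<forall>y\<in>Z2. \<forall>x\<in>X1. \<not> adj y x" using sympD[OF assms(1)] by blast
  then have "some_nbrs adj Y2 X2 \<inter> X1 = {}" unfolding assms(3) by (auto simp: some_nbrs_def)
  then have "\<forall>y\<in>X2. \<forall>x\<in>X1. \<not> adj y x" using assms(4) by (auto simp: some_nbrs_def)
  then show ?thesis using sympD[OF assms(1)] by blast
qed

lemma complete_transfer:
  assumes "symp adj" "all_nbrs adj Y1 X1 = all_nbrs adj Y1 Z1" "all_nbrs adj Y2 X2 = all_nbrs adj Y2 Z2"
    "X1 \<subseteq> Y2" "Z2 \<subseteq> Y1" "\<forall>x\<in>Z1. \<forall>y\<in>Z2. adj x y"
  shows "\<forall>x\<in>X1. \<forall>y\<in>X2. adj x y"
proof -
  have "\<forall>x\<in>X1. \<forall>y\<in>Z2. adj x y" using assms(2,5,6) by (auto simp: all_nbrs_def set_eq_iff)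
  then have "\<forall>y\<in>Z2. \<forall>x\<in>X1. adj y x" using sympD[OF assms(1)] by blast
  then have "X1 \<subseteq> all_nbrs adj Y2 X2" using assms(4) unfolding assms(3) by (auto simp: all_nbrs_def)
  then have "\<forall>y\<in>X2. \<forall>x\<in>X1. adj y x" by (auto simp: all_nbrs_def)
  then show ?thesis using sympD[OF assms(1)] by blast
qed

lemma some_nbrs_Un: "some_nbrs adj Y (X \<union> Z) = some_nbrs adj Y X \<union> some_nbrs adj Y Z"
  by (auto simp: some_nbrs_def)

lemma all_nbrs_Un: "all_nbrs adj Y (X \<union> Z) = all_nbrs adj Y X \<inter> all_nbrs adj Y Z"
  by (auto simp: all_nbrs_def)

lemma some_nbrs_eq_mono:
  "some_nbrs adj Z X = some_nbrs adj Z X' \<Longrightarrow> Y \<subseteq> Z \<Longrightarrow> some_nbrs adj Y X = some_nbrs adj Y X'"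
  unfolding some_nbrs_def by blast

lemma all_nbrs_eq_mono:
  "all_nbrs adj Z X = all_nbrs adj Z X' \<Longrightarrow> Y \<subseteq> Z \<Longrightarrow> all_nbrs adj Y X = all_nbrs adj Y X'"
  unfolding all_nbrs_def by blast

text \<open>Justifies discarding: the winner of a key collision represents every \<open>S\<close>
  that the loser did.\<close>

lemma represents_key_cong:
  assumes "chain_cut adj A (set out)" "distinct out" "valid adj A e" "valid adj A e'"
    "represents adj S A (set out) e" "key adj out e' = key adj out e" "entry_size e \<le> entry_size e'"
  shows "represents adj S A (set out) e'"
proof -
  obtain C R C' R' where e: "e = (C, R)" "e' = (C', R')" by (cases e, cases e')
  have sub: "set C \<subseteq> A" "set R \<subseteq> A" "set C' \<subseteq> A" "set R' \<subseteq> A"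
    using assms(3,4) by (auto simp: e)
  have c: "count_any adj R' out = count_any adj R out" "count_any adj C' out = count_any adj C out"
    "count_all adj C' out = count_all adj C out"
    using assms(6) by (simp_all add: e)
  have "some_nbrs adj (set out) (set C') = some_nbrs adj (set out) (set C)"
    using c(2) sub by (intro some_nbrs_eq_of_card[OF assms(1)]) (simp_all add: count_any_card assms(2))
  moreover have "all_nbrs adj (set out) (set C') = all_nbrs adj (set out) (set C)"
    using c(3) sub by (intro all_nbrs_eq_of_card[OF assms(1)]) (simp_all add: count_all_card assms(2))
  moreover have "some_nbrs adj (set out) (set R') = some_nbrs adj (set out) (set R)"
    using c(1) sub by (intro some_nbrs_eq_of_card[OF assms(1)]) (simp_all add: count_any_card assms(2))
  ultimately show ?thesis using assms(5,7) by (simp add: e)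
qed

text \<open>The case distinction is whether the two growing cliques \<open>K\<close> and \<open>L\<close> are the two halves of
  one clique of \<open>S\<close>; by \<open>anti_transfer\<close> and \<open>complete_transfer\<close> their representatives in the
  tables see each other the same way.\<close>

lemma candidates_complete:
  assumes s: "symp adj" and S: "p3_free adj S"
    and disj: "A \<inter> B = {}" "A \<inter> Y = {}" "B \<inter> Y = {}"
    and ch: "chain_cut adj (A \<union> B) Y" "chain_cut adj A (B \<union> Y)" "chain_cut adj B (A \<union> Y)"
    and v: "valid adj A e1" "valid adj B e2"
    and r: "represents adj S A (B \<union> Y) e1" "represents adj S B (A \<union> Y) e2"
  shows "\<exists>e \<in> set (candidates adj e1 e2). represents adj S (A \<union> B) Y e"
proof -
  define K L where "K = trace adj S A (B \<union> Y)" and "L = trace adj S B (A \<union> Y)"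
  define T where "T = trace adj S (A \<union> B) Y"
  define P Q where "P = S \<inter> A - K" and "Q = S \<inter> B - L"
  obtain C1 R1 C2 R2 where e: "e1 = (C1, R1)" "e2 = (C2, R2)" by (cases e1, cases e2)
  have r1: "some_nbrs adj (B \<union> Y) (set C1) = some_nbrs adj (B \<union> Y) K" "all_nbrs adj (B \<union> Y) (set C1) = all_nbrs adj (B \<union> Y) K"
    "some_nbrs adj (B \<union> Y) (set R1) = some_nbrs adj (B \<union> Y) P" "card (S \<inter> A) \<le> length C1 + length R1"
    using r(1) by (simp_all add: e K_def P_def)
  have r2: "some_nbrs adj (A \<union> Y) (set C2) = some_nbrs adj (A \<union> Y) L" "all_nbrs adj (A \<union> Y) (set C2) = all_nbrs adj (A \<union> Y) L"
    "some_nbrs adj (A \<union> Y) (set R2) = some_nbrs adj (A \<union> Y) Q" "card (S \<inter> B) \<le> length C2 + length R2"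
    using r(2) by (simp_all add: e L_def Q_def)
  have sub: "set C1 \<subseteq> A \<union> Y" "set R1 \<subseteq> A \<union> Y" using v e by auto
  have sub': "K \<subseteq> S \<inter> A" "P \<subseteq> S \<inter> A" "L \<subseteq> S \<inter> B" "Q \<subseteq> S \<inter> B"
    by (auto simp: K_def L_def P_def Q_def trace_def)
  have PS: "\<not> adj x y" if "x \<in> P" "y \<in> S" "y \<in> B \<union> Y" for x y
    using that by (auto simp: P_def K_def trace_def)
  have QS: "\<not> adj x y" if "x \<in> Q" "y \<in> S" "y \<in> A \<union> Y" for x y
    using that by (auto simp: Q_def L_def trace_def)
  have LQ: "L \<subseteq> B \<union> Y" "Q \<subseteq> B \<union> Y" using sub' by auto
  have PL: "\<forall>x\<in>P. \<forall>y\<in>L. \<not> adj x y" and PQ: "\<forall>x\<in>P. \<forall>y\<in>Q. \<not> adj x y"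
    using PS sub' by blast+
  have "\<forall>x\<in>Q. \<forall>y\<in>K. \<not> adj x y" using QS sub' by blast
  then have KQ: "\<forall>x\<in>K. \<forall>y\<in>Q. \<not> adj x y" using sympD[OF s] by blast
  have "\<forall>x\<in>set R1. \<forall>y\<in>set C2. \<not> adj x y"
    by (rule anti_transfer[OF s r1(3) r2(1) sub(2) LQ(1) PL])
  moreover have "\<forall>x\<in>set R1. \<forall>y\<in>set R2. \<not> adj x y"
    by (rule anti_transfer[OF s r1(3) r2(3) sub(2) LQ(2) PQ])
  moreover have "\<forall>x\<in>set C1. \<forall>y\<in>set R2. \<not> adj x y"
    by (rule anti_transfer[OF s r1(1) r2(3) sub(1) LQ(2) KQ])
  ultimately have ok: "count_any adj R1 C2 + count_any adj R1 R2 + count_any adj C1 R2 = 0"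
    using count_any_eq_0[of adj R1 C2] count_any_eq_0[of adj R1 R2] count_any_eq_0[of adj C1 R2]
    by simp
  have Kc: "clique adj K" and Lc: "clique adj L" and Tc: "clique adj T"
    unfolding K_def L_def T_def by (intro trace_clique s S ch)+
  have SAB: "S \<inter> (A \<union> B) = K \<union> P \<union> L \<union> Q"
    by (auto simp: P_def Q_def K_def L_def trace_def)
  have TKL: "T \<subseteq> K \<union> L" by (auto simp: T_def K_def L_def trace_def)
  have p3: "adj x z" if "adj x y" "adj y z" "x \<in> S" "y \<in> S" "z \<in> S" "x \<noteq> z" for x y z
    using S that unfolding p3_free_def by blast
  \<comment> \<open>A neighbour of \<open>y\<close> in \<open>S\<close> also sees the vertex of
    \<open>Y\<close> that \<open>y\<close> sees, by P3-freeness. Hence each of the cliques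
    \<open>K\<close> and \<open>L\<close> lies inside \<open>T\<close> or misses it.\<close>
  have T_closed: "x \<in> T" if x: "x \<in> S \<inter> (A \<union> B)" and y: "y \<in> T" and xy: "x = y \<or> adj x y" for x y
  proof (cases "x = y")
    case False
    obtain f where f: "f \<in> S" "f \<in> Y" "adj y f" "y \<in> S" using y by (auto simp: T_def trace_def)
    then have "adj x f" using p3[of x y f] x xy False disj by auto
    then show ?thesis using x f by (auto simp: T_def trace_def)
  qed (use y in simp)
  have KT: "K \<inter> T = {} \<or> K \<subseteq> T" using T_closed Kc sub' unfolding clique_def by blast
  have LT: "L \<inter> T = {} \<or> L \<subseteq> T" using T_closed Lc sub' unfolding clique_def by blast
  have card: "card (S \<inter> (A \<union> B)) \<le> length C1 + length R1 + (length C2 + length R2)"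
    using r1 r2 card_Un_le[of "S \<inter> A" "S \<inter> B"] by (simp add: Int_Un_distrib)
  have Y: "some_nbrs adj Y (set C1) = some_nbrs adj Y K" "some_nbrs adj Y (set C2) = some_nbrs adj Y L"
    "all_nbrs adj Y (set C1) = all_nbrs adj Y K" "all_nbrs adj Y (set C2) = all_nbrs adj Y L"
    "some_nbrs adj Y (set R1) = some_nbrs adj Y P" "some_nbrs adj Y (set R2) = some_nbrs adj Y Q"
    using some_nbrs_eq_mono[OF r1(1)] some_nbrs_eq_mono[OF r2(1)] all_nbrs_eq_mono[OF r1(2)] all_nbrs_eq_mono[OF r2(2)]
      some_nbrs_eq_mono[OF r1(3)] some_nbrs_eq_mono[OF r2(3)] by simp_all
  have PT: "P \<inter> T = {}" "Q \<inter> T = {}" using TKL sub' disj by (auto simp: P_def Q_def)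
  have KL: "K \<inter> L = {}" using sub' disj by auto
  \<comment> \<open>If no clique crosses the next cut, everything retires. Both branches of
    \<open>candidates\<close> offer this entry, so it is available however \<open>K\<close> and
    \<open>L\<close> see each other.\<close>
  have rest_all: "represents adj S (A \<union> B) Y ([], rev (rev C1 @ C2) @ rev R1 @ R2)" if "T = {}"
    using that card Y by (simp add: T_def[symmetric] SAB some_nbrs_Un Un_ac some_nbrs_def[of adj Y "{}"])
  show ?thesis
  proof (cases "\<exists>x\<in>K. \<exists>y\<in>L. adj x y")
    case True
    then obtain x y where xy: "x \<in> K" "y \<in> L" "adj x y" by blast
    have "adj x' y'" if K': "x' \<in> K" and L': "y' \<in> L" for x' y'
    proof -
      have S4: "x \<in> S" "y \<in> S" "x' \<in> S" "y' \<in> S" "x' \<noteq> y" "x' \<noteq> y'"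
        using xy K' L' sub' disj(1) by blast+
      have "x' = x \<or> adj x' x" using Kc K' xy(1) unfolding clique_def by blast
      then have "adj x' y" using p3[of x' x y] xy(3) S4 by blast
      moreover have "y = y' \<or> adj y y'" using Lc L' xy(2) unfolding clique_def by blast
      ultimately show ?thesis using p3[of x' y y'] S4 by blast
    qed
    then have KL': "\<forall>x\<in>K. \<forall>y\<in>L. adj x y" by blast
    then have "\<forall>x\<in>set C1. \<forall>y\<in>set C2. adj x y"
      by (rule complete_transfer[OF s r1(2) r2(2) sub(1) LQ(1)])
    then have full: "count_all adj C1 C2 = length C2" by (simp add: count_all_eq_length)
    \<comment> \<open>Both cliques are nonempty and completely joined here, so membership in
      \<open>T\<close> spreads from either one to the other.\<close>
    have KTL: "K \<inter> T \<noteq> {} \<longleftrightarrow> L \<inter> T \<noteq> {}"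
      using T_closed KL' xy sub' sympD[OF s] by blast
    show ?thesis
    proof (cases "T = {}")
      case True
      then show ?thesis using rest_all ok full by (auto simp: e Let_def)
    next
      case False
      then have TE: "T = K \<union> L" using TKL KT LT KTL by blast
      then have "S \<inter> (A \<union> B) - T = P \<union> Q" using SAB PT by blast
      then have "represents adj S (A \<union> B) Y (rev C1 @ C2, rev R1 @ R2)"
        using card Y TE by (simp add: T_def[symmetric] some_nbrs_Un all_nbrs_Un)
      then show ?thesis using ok full by (auto simp: e Let_def)
    qed
  next
    case False
    then have "\<forall>x\<in>K. \<forall>y\<in>L. \<not> adj x y" by blast
    then have "\<forall>x\<in>set C1. \<forall>y\<in>set C2. \<not> adj x y"
      by (rule anti_transfer[OF s r1(1) r2(1) sub(1) LQ(1)])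
    then have none: "count_any adj C1 C2 = 0" by (simp add: count_any_eq_0)
    \<comment> \<open>\<open>T\<close> is a clique, so it cannot meet both of two cliques without
      edges between them.\<close>
    have "\<not> (x \<in> K \<inter> T \<and> y \<in> L \<inter> T)" for x y
    proof
      assume "x \<in> K \<inter> T \<and> y \<in> L \<inter> T"
      moreover from this have "x \<noteq> y" using KL by blast
      ultimately show False using False Tc unfolding clique_def by blast
    qed
    then have "K \<inter> T = {} \<or> L \<inter> T = {}" by blast
    then consider "T = {}" | "T = K" | "T = L" using TKL KT LT by blast
    then show ?thesis
    proof cases
      case 1
      then show ?thesis using rest_all ok none by (auto simp: e Let_def)
    next
      case 2
      then have "S \<inter> (A \<union> B) - T = P \<union> Q \<union> L" using SAB PT KL by blast
      then have "represents adj S (A \<union> B) Y (C1, rev C2 @ rev R1 @ R2)"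
        using card Y 2 by (simp add: T_def[symmetric] some_nbrs_Un Un_ac)
      then show ?thesis using ok none by (auto simp: e Let_def)
    next
      case 3
      then have "S \<inter> (A \<union> B) - T = P \<union> Q \<union> K" using SAB PT KL by blast
      then have "represents adj S (A \<union> B) Y (C2, rev C1 @ rev R1 @ R2)"
        using card Y 3 by (simp add: T_def[symmetric] some_nbrs_Un Un_ac)
      then show ?thesis using ok none by (auto simp: e Let_def)
    qed
  qed
qed

lemma solve_complete:
  assumes "symp adj" "p3_free adj S" "distinct (leaves t @ out)" "chain_layout adj t out"
  shows "\<exists>e \<in> set (solve adj t out). represents adj S (set (leaves t)) (set out) e"
  using assms(3,4)
proof (induction t arbitrary: out)
  case (Leaf v)
  let ?T = "trace adj S {v} (set out)"
  \<comment> \<open>The cases match the three leaf entries: \<open>v\<close> absent,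
    \<open>v\<close> as growing clique, \<open>v\<close> in the rest.\<close>
  consider "v \<notin> S" | "v \<in> S" "v \<in> ?T" | "v \<in> S" "v \<notin> ?T" by blast
  then show ?case
  proof cases
    case 1
    then have "?T = {}" "S \<inter> {v} = {}" by (auto simp: trace_def)
    then show ?thesis by simp
  next
    case 2
    then have "?T = {v}" "S \<inter> {v} = {v}" by (auto simp: trace_def)
    then show ?thesis by simp
  next
    case 3
    then have "?T = {}" "S \<inter> {v} = {v}" by (auto simp: trace_def)
    then show ?thesis by simp
  qed
next
  case (Node l r)
  let ?A = "set (leaves l)" and ?B = "set (leaves r)"
  obtain e1 where e1: "e1 \<in> set (solve adj l (leaves r @ out))"
    "represents adj S ?A (?B \<union> set out) e1"
    using Node.IH(1)[of "leaves r @ out"] Node.prems by (auto simp del: represents.simps)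
  obtain e2 where e2: "e2 \<in> set (solve adj r (leaves l @ out))"
    "represents adj S ?B (?A \<union> set out) e2"
    using Node.IH(2)[of "leaves l @ out"] Node.prems
    by (auto simp del: represents.simps simp: Int_commute Int_Un_distrib)
  have v: "valid adj ?A e1" "valid adj ?B e2"
    using solve_valid[OF assms(1)] e1 e2 Node.prems by auto
  have "\<exists>e \<in> set (candidates adj e1 e2). represents adj S (?A \<union> ?B) (set out) e"
    using Node.prems e1 e2 v by (intro candidates_complete[OF assms(1,2)]) auto
  then obtain e where e: "e \<in> set (candidates adj e1 e2)" "represents adj S (?A \<union> ?B) (set out) e" by blast
  \<comment> \<open>The representing candidate may have lost its place to \<open>e'\<close>; the
    equal key lets \<open>e'\<close> represent \<open>S\<close> as well.\<close>
  obtain e' where e': "e' \<in> set (solve adj (Node l r) out)" "key adj out e' = key adj out e"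
    "entry_size e \<le> entry_size e'" using combine_correct(3)[OF e1(1) e2(1) e(1), of out] unfolding solve.simps by blast
  have "valid adj (?A \<union> ?B) e'"
    using solve_valid[OF assms(1) _ e'(1)] Node.prems by auto
  moreover have "valid adj (?A \<union> ?B) e"
    using candidates_valid[OF assms(1) v _ e(1)] Node.prems by auto
  ultimately have "represents adj S (?A \<union> ?B) (set out) e'"
    using represents_key_cong[OF _ _ _ _ e(2) e'(2,3)] Node.prems by simp
  then show ?case using e'(1) by auto
qed

section \<open>Cluster graphs as P3-free sets, and chain cuts from mim-width\<close>

text \<open>P3-freeness shortcuts every walk: reachable vertices are equal or adjacent, so
  components are complete. Conversely the ends of a path on three vertices share a
  component.\<close>

lemma p3_free_iff:
  assumes "S \<subseteq> verts G"
  shows "cluster_graph (induced_subgraph G S) \<longleftrightarrow> p3_free (\<lambda>u v. {u, v} \<in> edges G) S"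
proof -
  define E where "E = {(x, y). {x, y} \<in> edges (induced_subgraph G S)}"
  have E: "(x, y) \<in> E \<longleftrightarrow> {x, y} \<in> edges G \<and> x \<in> S \<and> y \<in> S" for x y
    by (auto simp: E_def induced_subgraph_def)
  have cg: "cluster_graph (induced_subgraph G S) \<longleftrightarrow>
    (\<forall>u\<in>S. \<forall>v\<in>S. \<forall>w\<in>S. (u, v) \<in> E\<^sup>* \<longrightarrow> (u, w) \<in> E\<^sup>* \<longrightarrow> v \<noteq> w \<longrightarrow> {v, w} \<in> edges G)"
    unfolding cluster_graph_def connected_components_def complete_graph_def E_def[symmetric]
    by (auto simp: induced_subgraph_def)
  show ?thesis unfolding cg
  proof (intro iffI)
    assume h: "\<forall>u\<in>S. \<forall>v\<in>S. \<forall>w\<in>S. (u, v) \<in> E\<^sup>* \<longrightarrow> (u, w) \<in> E\<^sup>* \<longrightarrow> v \<noteq> w \<longrightarrow> {v, w} \<in> edges G"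
    show "p3_free (\<lambda>u v. {u, v} \<in> edges G) S"
      unfolding p3_free_def
    proof (intro ballI impI)
      fix u v w assume "u \<in> S" "v \<in> S" "w \<in> S" "{u, v} \<in> edges G" "{v, w} \<in> edges G" "u \<noteq> w"
      moreover from this have "(u, w) \<in> E\<^sup>*"
        using E by (metis converse_rtrancl_into_rtrancl r_into_rtrancl)
      ultimately show "{u, w} \<in> edges G" using h by blast
    qed
  next
    assume p: "p3_free (\<lambda>u v. {u, v} \<in> edges G) S"
    have step: "u = v \<or> (u, v) \<in> E" if "(u, v) \<in> E\<^sup>*" for u v
      using that
    proof (induction rule: rtrancl_induct)
      case (step y z)
      then show ?case using p E unfolding p3_free_def by metis
    qed simp
    show "\<forall>u\<in>S. \<forall>v\<in>S. \<forall>w\<in>S. (u, v) \<in> E\<^sup>* \<longrightarrow> (u, w) \<in> E\<^sup>* \<longrightarrow> v \<noteq> w \<longrightarrow> {v, w} \<in> edges G"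
    proof (intro ballI impI)
      fix u v w assume *: "u \<in> S" "v \<in> S" "w \<in> S" "(u, v) \<in> E\<^sup>*" "(u, w) \<in> E\<^sup>*" "v \<noteq> w"
      have "(v, u) \<in> E\<^sup>*" using step[OF *(4)] E by (metis insert_commute r_into_rtrancl rtrancl.rtrancl_refl)
      then have "(v, w) \<in> E\<^sup>*" using *(5) by simp
      then show "{v, w} \<in> edges G" using step *(6) E by blast
    qed
  qed
qed

text \<open>Incomparable neighbourhoods of \<open>u\<close> and \<open>v\<close> provide private
  neighbours \<open>x\<close> and \<open>y\<close>. The edges \<open>ux\<close> and
  \<open>vy\<close> then form an induced matching of size 2; possible edges \<open>uv\<close> and
  \<open>xy\<close> stay inside a side and are absent from the cut graph.\<close>

lemma chain_cut_of_mim: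
  assumes G: "simple_graph G" and A: "A \<subseteq> verts G" and m: "mim G A \<le> 1"
  shows "chain_cut (\<lambda>u v. {u, v} \<in> edges G) A (verts G - A)"
proof (rule ccontr)
  assume "\<not> ?thesis"
  then obtain u v x y where uv: "u \<in> A" "v \<in> A" "x \<in> verts G - A" "y \<in> verts G - A"
    "{u, x} \<in> edges G" "{v, x} \<notin> edges G" "{v, y} \<in> edges G" "{u, y} \<notin> edges G"
    by (auto simp: chain_cut_def some_nbrs_def subset_iff)
  have ne: "u \<noteq> v" "x \<noteq> y" using uv by auto
  let ?M = "{{u, x}, {v, y}}"
  have loop: "{z, z} \<notin> edges G" for z using G by (auto simp: simple_graph_def)
  have "e \<in> ?M" if "e \<in> edges G" "e \<inter> A \<noteq> {}" "e \<inter> (verts G - A) \<noteq> {}" "e \<subseteq> {u, x, v, y}" for e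
  proof -
    have "e \<inter> A \<noteq> {}" "e \<inter> (verts G - A) \<noteq> {}" by fact+
    then obtain a b where "a \<in> e" "a \<in> A" "b \<in> e" "b \<in> verts G - A" by blast
    moreover obtain c d where "e = {c, d}" using G \<open>e \<in> edges G\<close> by (auto simp: simple_graph_def)
    ultimately have "e = {a, b}" "a \<in> {u, v}" "b \<in> {x, y}" using \<open>e \<subseteq> {u, x, v, y}\<close> uv by auto
    then show ?thesis using \<open>e \<in> edges G\<close> uv by (auto simp: insert_commute)
  qed
  then have "{e \<in> {e \<in> edges G. e \<inter> A \<noteq> {} \<and> e \<inter> (verts G - A) \<noteq> {}}. e \<subseteq> \<Union>?M} = ?M"
    using uv by auto
  then have "induced_matching (cut_graph G A) ?M"
    using uv ne unfolding induced_matching_def cut_graph_def induced_subgraph_def by auto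
  moreover have "finite {M. induced_matching (cut_graph G A) M}"
  proof (rule finite_subset)
    show "{M. induced_matching (cut_graph G A) M} \<subseteq> Pow (Pow (verts G))"
      using G by (auto simp: induced_matching_def cut_graph_def simple_graph_def)
  qed (use G in \<open>auto simp: simple_graph_def\<close>)
  ultimately have "card ?M \<le> mim G A" unfolding mim_def by (intro Max_ge) auto
  moreover have "card ?M = 2" using ne uv by (auto simp: card_insert_if doubleton_eq_iff)
  ultimately show False using m by simp
qed

lemma finite_edge_cuts: "finite (edge_cuts T)"
  by (induction T) auto

text \<open>The induction keeps \<open>out\<close> equal, as a set, to the complement of the
  subtree, so the cuts it meets below the root are exactly those of tree edges.\<close>

lemma chain_layout_of_mim_width:
  assumes G: "simple_graph G" and L: "rooted_layout G T" and m: "mim_width G T \<le> 1"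
  shows "chain_layout (\<lambda>u v. {u, v} \<in> edges G) T []"
proof -
  let ?adj = "\<lambda>u v. {u, v} \<in> edges G"
  have cut: "chain_cut ?adj A (verts G - A)" if "A \<in> edge_cuts T" "A \<subseteq> verts G" for A
  proof (rule chain_cut_of_mim[OF G that(2)])
    have "mim G A \<le> mim_width G T"
      unfolding mim_width_def using that(1) finite_edge_cuts by (intro Max_ge) auto
    then show "mim G A \<le> 1" using m by simp
  qed
  have "chain_layout ?adj t out"
    if "edge_cuts t \<subseteq> edge_cuts T" "chain_cut ?adj (set (leaves t)) (set out)"
      "distinct (leaves t @ out)" "set (leaves t @ out) = verts G" for t out
    using that
  proof (induction t arbitrary: out)
    case (Node l r)
    have "verts G - set (leaves l) = set (leaves r @ out)"
      "verts G - set (leaves r) = set (leaves l @ out)" using Node.prems(3,4) by auto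
    then have "chain_cut ?adj (set (leaves l)) (set (leaves r @ out))"
      "chain_cut ?adj (set (leaves r)) (set (leaves l @ out))"
      using cut[of "set (leaves l)"] cut[of "set (leaves r)"] Node.prems(1,4) by auto
    moreover have "chain_layout ?adj l (leaves r @ out)" "chain_layout ?adj r (leaves l @ out)"
      using Node.prems calculation by (intro Node.IH; auto)+
    ultimately show ?case using Node.prems(2) by simp
  qed simp
  then show ?thesis using L by (simp add: rooted_layout_def chain_cut_def some_nbrs_def)
qed

theorem solve_max_induced_cluster:
  assumes G: "simple_graph G" and L: "rooted_layout G T" and m: "mim_width G T \<le> 1"
  shows "\<exists>C R tbl. solve (\<lambda>u v. {u, v} \<in> edges G) T [] = (C, R) # tbl \<and> distinct (C @ R) \<and>
    max_induced_cluster G (set (C @ R))"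
proof -
  let ?adj = "\<lambda>u v. {u, v} \<in> edges G"
  have s: "symp ?adj" by (auto simp: symp_def insert_commute)
  have d: "distinct (leaves T)" "set (leaves T) = verts G" using L by (auto simp: rooted_layout_def)
  have "\<exists>e tbl. solve ?adj T [] = e # tbl \<and> (\<forall>f \<in> set (solve ?adj T []). entry_size f \<le> entry_size e)"
  proof (cases T)
    case (Node l r)
    \<comment> \<open>At the root nothing lies outside, so all keys coincide and distinctness leaves
      at most one entry.\<close>
    have k: "key ?adj [] e = (0, 0, 0)" for e by (cases e) (simp add: count_any_def count_all_def)
    have "distinct (map (key ?adj []) (solve ?adj T []))" by (simp add: Node combine_correct)
    then have "distinct (map (\<lambda>_. (0::nat, 0::nat, 0::nat)) (solve ?adj T []))"
      by (simp only: k[abs_def])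
    then have "length (solve ?adj T []) \<le> 1"
      by (cases "solve ?adj T []" rule: remdups_adj.cases) auto
    \<comment> \<open>Completeness for the empty set already yields an entry.\<close>
    moreover have "solve ?adj T [] \<noteq> []"
      using solve_complete[OF s, of "{}" T "[]"] chain_layout_of_mim_width[OF assms] d
      by (auto simp: p3_free_def)
    ultimately show ?thesis by (cases "solve ?adj T []") auto
  qed auto
  then obtain C R tbl where e: "solve ?adj T [] = (C, R) # tbl"
    "\<forall>f \<in> set (solve ?adj T []). entry_size f \<le> entry_size (C, R)" by (metis surj_pair)
  have v: "valid ?adj (verts G) (C, R)" using solve_valid[OF s d(1), of "(C, R)" "[]"] e d by simp
  have "p3_free ?adj (set C \<union> set R)"
    using v by (intro p3_free_Un[OF s clique_p3_free]) auto
  moreover have "card S \<le> card (set (C @ R))"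
    if S: "S \<subseteq> verts G" "cluster_graph (induced_subgraph G S)" for S
  proof -
    obtain f where f: "f \<in> set (solve ?adj T [])" "represents ?adj S (verts G) {} f"
      using solve_complete[OF s, of S T "[]"] chain_layout_of_mim_width[OF assms] d
        p3_free_iff[OF S(1)] S(2) by auto
    then have "card (S \<inter> verts G) \<le> entry_size f" by (metis represents.elims(2))
    also have "\<dots> \<le> length (C @ R)" using e(2) f(1) by auto
    also have "\<dots> = card (set (C @ R))" using v by (metis distinct_card valid.simps)
    finally show ?thesis using S(1) by (simp add: Int_absorb2)
  qed
  ultimately have "max_induced_cluster G (set (C @ R))"
    unfolding max_induced_cluster_def using v p3_free_iff[of "set (C @ R)" G] by auto
  then show ?thesis using e(1) v by auto
qed

section \<open>Evaluation by simplification\<close>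

text \<open>The functions \<open>val_of\<close> and \<open>time_of\<close> recurse over a single expression and stop at calls, so
  the simplifier can run a function body once the values and times of its calls are known.\<close>

definition call_val :: "program \<Rightarrow> nat \<Rightarrow> val list \<Rightarrow> val option" where
  "call_val P f vs = (if f < length P \<and> (\<exists>v t. eval P vs (P ! f) v t)
     then Some (SOME v. \<exists>t. eval P vs (P ! f) v t) else None)"

definition call_time :: "program \<Rightarrow> nat \<Rightarrow> val list \<Rightarrow> nat" where
  "call_time P f vs = (SOME t. \<exists>v. eval P vs (P ! f) v t)"

fun val_of :: "program \<Rightarrow> val list \<Rightarrow> expr \<Rightarrow> val option"
  and vals_of :: "program \<Rightarrow> val list \<Rightarrow> expr list \<Rightarrow> val list option" where
  "val_of P env (Var i) = (if i < length env then Some (env ! i) else None)"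
| "val_of P env (Const n) = Some (Num n)"
| "val_of P env (Prim f es) = (case vals_of P env es of None \<Rightarrow> None | Some vs \<Rightarrow> apply_prim f vs)"
| "val_of P env (Cond c a b) =
     (case val_of P env c of Some (Num k) \<Rightarrow> if k \<noteq> 0 then val_of P env a else val_of P env b | _ \<Rightarrow> None)"
| "val_of P env (LetIn a e) = (case val_of P env a of None \<Rightarrow> None | Some w \<Rightarrow> val_of P (w # env) e)"
| "val_of P env (Call f es) = (case vals_of P env es of None \<Rightarrow> None | Some vs \<Rightarrow> call_val P f vs)"
| "vals_of P env [] = Some []"
| "vals_of P env (e # es) = (case val_of P env e of None \<Rightarrow> None | Some v \<Rightarrow>
     (case vals_of P env es of None \<Rightarrow> None | Some vs \<Rightarrow> Some (v # vs)))"

fun time_of :: "program \<Rightarrow> val list \<Rightarrow> expr \<Rightarrow> nat"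
  and times_of :: "program \<Rightarrow> val list \<Rightarrow> expr list \<Rightarrow> nat" where
  "time_of P env (Var i) = 1"
| "time_of P env (Const n) = 1"
| "time_of P env (Prim f es) = times_of P env es + 1"
| "time_of P env (Cond c a b) = time_of P env c + (case val_of P env c of Some (Num k) \<Rightarrow>
     if k \<noteq> 0 then time_of P env a else time_of P env b | _ \<Rightarrow> 0) + 1"
| "time_of P env (LetIn a e) =
     time_of P env a + (case val_of P env a of None \<Rightarrow> 0 | Some w \<Rightarrow> time_of P (w # env) e) + 1"
| "time_of P env (Call f es) =
     times_of P env es + (case vals_of P env es of None \<Rightarrow> 0 | Some vs \<Rightarrow> call_time P f vs) + 1"
| "times_of P env [] = 0"
| "times_of P env (e # es) = time_of P env e + times_of P env es"

text \<open>Value and time are chosen independently; determinism is what makes them belong to one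
  derivation.\<close>

lemma eval_call:
  assumes "call_val P f vs = Some v"
  shows "f < length P" "eval P vs (P ! f) v (call_time P f vs)"
proof -
  show f: "f < length P" using assms by (auto simp: call_val_def split: if_splits)
  obtain w t where w: "eval P vs (P ! f) w t"
    using assms by (auto simp: call_val_def split: if_splits)
  have v: "(\<exists>t. eval P vs (P ! f) u t) \<longleftrightarrow> u = w" for u
    using w eval_deterministic(1) by blast
  have t: "(\<exists>v. eval P vs (P ! f) v s) \<longleftrightarrow> s = t" for s
    using w eval_deterministic(1) by blast
  have "v = w" using assms f w by (auto simp: call_val_def v)
  then show "eval P vs (P ! f) v (call_time P f vs)" using w by (simp add: call_time_def t)
qed

lemma eval_val_of:
  "val_of P env e = Some v \<Longrightarrow> eval P env e v (time_of P env e)"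
  "vals_of P env es = Some vs \<Longrightarrow> evals P env es vs (times_of P env es)"
proof (induction P env e and P env es arbitrary: v and vs rule: val_of_vals_of.induct)
  case (1 P env i)
  then show ?case by (auto intro: eval_Var[simplified] split: if_splits)
next
  case (2 P env n)
  then show ?case by (auto intro: eval_Const[simplified])
next
  case (3 P env f es)
  then show ?case by (auto intro!: eval_Prim[simplified] split: option.splits)
next
  case (4 P env c a b)
  then obtain k where k: "val_of P env c = Some (Num k)" by (auto split: option.splits val.splits)
  then have "eval P env (Cond c a b) v
    (time_of P env c + (if k \<noteq> 0 then time_of P env a else time_of P env b) + 1)"
    using 4 by (intro eval_Cond) (auto split: if_splits)
  then show ?case using k by simp
next
  case (5 P env a e)
  then show ?case by (auto intro!: eval_LetIn[simplified] split: option.splits)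
next
  case (6 P env f es)
  then show ?case by (auto intro!: eval_Call[simplified] eval_call split: option.splits)
next
  case (7 P env)
  then show ?case by (auto intro: evals_Nil)
next
  case (8 P env e es)
  then show ?case by (auto intro!: evals_Cons split: option.splits)
qed

definition runs :: "program \<Rightarrow> nat \<Rightarrow> val list \<Rightarrow> val \<Rightarrow> nat \<Rightarrow> bool" where
  "runs P f vs v b \<longleftrightarrow> call_val P f vs = Some v \<and> call_time P f vs \<le> b"

lemma runsD: "runs P f vs v b \<Longrightarrow> call_val P f vs = Some v" "runs P f vs v b \<Longrightarrow> call_time P f vs \<le> b"
  by (auto simp: runs_def)

text \<open>Opens exactly one call. Inner calls are resolved by \<open>runs\<close> facts proved
  beforehand, or by the induction hypothesis for a recursive function.\<close>

lemma runsI: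
  assumes "f < length P" "val_of P vs (P ! f) = Some v" "time_of P vs (P ! f) \<le> b"
  shows "runs P f vs v b"
proof -
  have e: "eval P vs (P ! f) v (time_of P vs (P ! f))" using assms(2) by (rule eval_val_of)
  have "(\<exists>t. eval P vs (P ! f) u t) \<longleftrightarrow> u = v" for u
    using e eval_deterministic(1) by blast
  then have c: "call_val P f vs = Some v"
    using assms(1) by (simp add: call_val_def)
  have "call_time P f vs = time_of P vs (P ! f)"
    using eval_call(2)[OF c] e eval_deterministic(1) by blast
  then show ?thesis using c assms(3) by (simp add: runs_def)
qed

lemma runs_mono: "runs P f vs v b \<Longrightarrow> b \<le> b' \<Longrightarrow> runs P f vs v b'"
  by (simp add: runs_def)

text \<open>The environment of a loop is the remaining list, the accumulator and a constant context.\<close>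

definition loop :: "nat \<Rightarrow> expr \<Rightarrow> expr" where
  "loop k body = Cond (Prim IsCell [Var 0]) (Call k [Prim Snd [Var 0], body, Var 2]) (Var 1)"

text \<open>One round costs 7 steps besides the body, the final test on the empty list 4;
  \<open>+ 10\<close> covers either, and \<open>m + 1\<close> counts that final test as a round. The
  invariant \<open>I\<close> carries what the body needs of the accumulator, such as distinct
  keys.\<close>

lemma runs_loop:
  assumes P: "k < length P" "P ! k = loop k body"
    and step: "\<And>x a r. x \<in> set xs \<Longrightarrow> I a \<Longrightarrow> I (g x a) \<and>
      val_of P [Cell (E x) r, A a, c] body = Some (A (g x a)) \<and> time_of P [Cell (E x) r, A a, c] body \<le> b"
    and "I a" "length xs \<le> m"
  shows "runs P k [enc_list (map E xs), A a, c] (A (fold g xs a)) ((b + 10) * (m + 1))"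
proof -
  have "runs P k [enc_list (map E xs), A a, c] (A (fold g xs a)) ((b + 10) * (length xs + 1))"
    using step \<open>I a\<close>
  proof (induction xs arbitrary: a)
    case Nil
    show ?case by (rule runsI) (simp_all add: P loop_def)
  next
    case (Cons x xs)
    let ?r = "enc_list (map E xs)"
    have s: "I (g x a)" "val_of P [Cell (E x) ?r, A a, c] body = Some (A (g x a))"
      "time_of P [Cell (E x) ?r, A a, c] body \<le> b" using Cons.prems by auto
    have r: "runs P k [?r, A (g x a), c] (A (fold g xs (g x a))) ((b + 10) * (length xs + 1))"
      using Cons.prems s(1) by (intro Cons.IH) auto
    show ?case
      using s runsD[OF r] by (intro runsI) (simp_all add: P loop_def algebra_simps)
  qed
  then show ?thesis using assms(5) by (elim runs_mono) simp
qed

definition poly_bounded :: "(nat \<Rightarrow> nat) \<Rightarrow> bool" where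
  "poly_bounded f \<longleftrightarrow> (\<exists>p. \<forall>n. f n = poly p n)"

lemma poly_bounded_intros:
  "poly_bounded (\<lambda>n. c)" "poly_bounded (\<lambda>n. n)"
  "poly_bounded f \<Longrightarrow> poly_bounded g \<Longrightarrow> poly_bounded (\<lambda>n. f n + g n)"
  "poly_bounded f \<Longrightarrow> poly_bounded g \<Longrightarrow> poly_bounded (\<lambda>n. f n * g n)"
  "poly_bounded f \<Longrightarrow> poly_bounded (\<lambda>n. f n ^ k)"
proof -
  show "poly_bounded (\<lambda>n. c)"
    unfolding poly_bounded_def by (rule exI[of _ "[:c:]"]) simp
  show "poly_bounded (\<lambda>n. n)"
    unfolding poly_bounded_def by (rule exI[of _ "[:0, 1:]"]) simp
  show "poly_bounded (\<lambda>n. f n ^ k)" if "poly_bounded f" for f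
  proof -
    from that obtain p where "\<And>n. f n = poly p n" by (auto simp: poly_bounded_def)
    then show ?thesis unfolding poly_bounded_def by (intro exI[of _ "p ^ k"]) simp
  qed
  assume "poly_bounded f" "poly_bounded g"
  then obtain p q where "\<And>n. f n = poly p n" "\<And>n. g n = poly q n"
    by (auto simp: poly_bounded_def)
  then show "poly_bounded (\<lambda>n. f n + g n)" "poly_bounded (\<lambda>n. f n * g n)"
    unfolding poly_bounded_def
    by - (intro exI[of _ "p + q"], simp, intro exI[of _ "p * q"], simp)
qed

section \<open>The program\<close>

text \<open>The functions of \<open>prog\<close> and their arguments:
  0 main (instance); 1 list access (list, index); 2 number of neighbours of \<open>y\<close> in \<open>X\<close>
  (\<open>X\<close>, accumulator, matrix and \<open>y\<close>); 3 length (list, accumulator, unused); 4 and 5 \<open>count_any\<close> and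
  \<open>count_all\<close> (\<open>Y\<close>, accumulator, matrix and \<open>X\<close>); 6 reverse append (list, list, unused);
  7 entry (\<open>C\<close>, \<open>R\<close>, matrix, out); 8 \<open>insert_step\<close> loop (table, new table, unused);
  9 \<open>insert_best\<close> (\<open>C\<close>, \<open>R\<close>, table, matrix, out);
  10 insertion of all candidates (\<open>C1\<close>, \<open>R1\<close>, \<open>C2\<close>, \<open>R2\<close>, table, matrix, out);
  11 and 12 the loops over the right and the left table; 13 leaves (layout, accumulator);
  14 \<open>solve\<close> (layout, matrix, out).\<close>

abbreviation "fstE x \<equiv> Prim Fst [x]"
abbreviation "sndE x \<equiv> Prim Snd [x]"
abbreviation "consE x y \<equiv> Prim Mk [x, y]"
abbreviation "adjE M x y \<equiv> Call 1 [Call 1 [M, x], y]"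
abbreviation "degE M X y \<equiv> Call 2 [X, Const 0, consE M y]"
abbreviation "lenE X \<equiv> Call 3 [X, Const 0, Const 0]"
abbreviation "anyE M X Y \<equiv> Call 4 [Y, Const 0, consE M X]"
abbreviation "allE M X Y \<equiv> Call 5 [Y, Const 0, consE M X]"
abbreviation "appE X Y \<equiv> Call 6 [X, Y, Const 0]"
abbreviation "insE C R T M out \<equiv> Call 9 [C, R, T, M, out]"

definition "nth_body = Cond (Var 1) (Call 1 [sndE (Var 0), Prim Minus [Var 1, Const 1]]) (fstE (Var 0))"
definition "deg_body = loop 2
  (Prim Plus [Var 1, adjE (fstE (Var 2)) (fstE (Var 0)) (sndE (Var 2))])"
definition "len_body = loop 3 (Prim Plus [Var 1, Const 1])"
text \<open>Both quantifiers over \<open>X\<close> are decided by the number of neighbours of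
  \<open>y\<close> in \<open>X\<close>: positive here, equal to the length of \<open>X\<close> in
  \<open>all_body\<close>.\<close>

definition "any_body = loop 4
  (Prim Plus [Var 1, Prim Lt [Const 0, degE (fstE (Var 2)) (sndE (Var 2)) (fstE (Var 0))]])"
definition "all_body = loop 5
  (Prim Plus [Var 1, Prim Eq [degE (fstE (Var 2)) (sndE (Var 2)) (fstE (Var 0)), lenE (sndE (Var 2))]])"
definition "app_body = loop 6 (consE (fstE (Var 0)) (Var 1))"
text \<open>Key and size are computed once and stored behind the two lists, so insertion compares
  numbers only.\<close>

definition "entry_body = consE (Var 0) (consE (Var 1) (consE (anyE (Var 2) (Var 1) (Var 3))
  (consE (anyE (Var 2) (Var 0) (Var 3)) (consE (allE (Var 2) (Var 0) (Var 3))
    (Prim Plus [lenE (Var 0), lenE (Var 1)])))))"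
abbreviation "keyE1 e \<equiv> fstE (sndE (sndE e))"
abbreviation "keyE2 e \<equiv> fstE (sndE (sndE (sndE e)))"
abbreviation "keyE3 e \<equiv> fstE (sndE (sndE (sndE (sndE e))))"
abbreviation "sizeE e \<equiv> sndE (sndE (sndE (sndE (sndE e))))"
definition "ins_step_body = loop 8 (LetIn (fstE (Var 0)) (LetIn (fstE (Var 2))
  (Cond (Cond (Prim Eq [keyE1 (Var 1), keyE1 (Var 0)])
      (Cond (Prim Eq [keyE2 (Var 1), keyE2 (Var 0)])
        (Prim Eq [keyE3 (Var 1), keyE3 (Var 0)]) (Const 0)) (Const 0))
    (consE (Cond (Prim Lt [sizeE (Var 0), sizeE (Var 1)]) (Var 1) (Var 0)) (sndE (Var 3)))
    (consE (Var 0) (consE (Var 1) (sndE (Var 3)))))))"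
definition "ins_body = Call 8
  [Var 2, consE (Call 7 [Var 0, Var 1, Var 3, Var 4]) (Const 0), Const 0]"
text \<open>The three \<open>LetIn\<close> put \<open>rev R1 @ R2\<close>, then \<open>rev C1 @ C2\<close>, then the table with the candidates
  of the merged clique in front of the arguments.\<close>
definition "join_body = Cond
  (Prim Plus [Prim Plus [anyE (Var 5) (Var 1) (Var 2), anyE (Var 5) (Var 1) (Var 3)],
     anyE (Var 5) (Var 0) (Var 3)])
  (Var 4)
  (LetIn (appE (Var 1) (Var 3)) (LetIn (appE (Var 1) (Var 3)) (LetIn
    (Cond (Prim Eq [allE (Var 7) (Var 2) (Var 4), lenE (Var 4)])
      (insE (Var 0) (Var 1) (insE (Const 0) (appE (Var 0) (Var 1)) (Var 6) (Var 7) (Var 8))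
         (Var 7) (Var 8))
      (Var 6))
    (Cond (anyE (Var 8) (Var 3) (Var 5)) (Var 0)
      (insE (Var 5) (appE (Var 3) (Var 2))
        (insE (Var 3) (appE (Var 5) (Var 2))
          (insE (Const 0) (appE (Var 1) (Var 2)) (Var 0) (Var 8) (Var 9)) (Var 8) (Var 9))
        (Var 8) (Var 9))))))"
definition "inner_body = loop 11 (Call 10 [fstE (fstE (Var 2)), fstE (sndE (fstE (Var 2))),
  fstE (fstE (Var 0)), fstE (sndE (fstE (Var 0))), Var 1, fstE (sndE (Var 2)), sndE (sndE (Var 2))])"
definition "outer_body = loop 12 (Call 11 [fstE (Var 2), Var 1, consE (fstE (Var 0)) (sndE (Var 2))])"
definition "leaves_body = Cond (Prim IsCell [Var 0])
  (Call 13 [fstE (Var 0), Call 13 [sndE (Var 0), Var 1]]) (consE (Var 0) (Var 1))"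
text \<open>\<open>Const 0\<close> serves as the empty list, both of vertices and of
  entries.\<close>

definition "solve_body = Cond (Prim IsCell [Var 0])
  (Call 12 [Call 14 [fstE (Var 0), Var 1, Call 13 [sndE (Var 0), Var 2]], Const 0,
     consE (Call 14 [sndE (Var 0), Var 1, Call 13 [fstE (Var 0), Var 2]]) (consE (Var 1) (Var 2))])
  (LetIn (consE (Var 0) (Const 0))
    (consE (Call 7 [Var 0, Const 0, Var 2, Var 3]) (consE (Call 7 [Const 0, Var 0, Var 2, Var 3])
      (consE (Call 7 [Const 0, Const 0, Var 2, Var 3]) (Const 0)))))"
definition "main_body = LetIn (fstE (Call 14 [sndE (Var 0), fstE (Var 0), Const 0]))
  (appE (fstE (Var 0)) (fstE (sndE (Var 0))))"

definition prog :: program where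
  "prog = [main_body, nth_body, deg_body, len_body, any_body, all_body, app_body, entry_body,
     ins_step_body, ins_body, join_body, inner_body, outer_body, leaves_body, solve_body]"

lemma prog_nth [simp]:
  "prog ! 0 = main_body" "prog ! Suc 0 = nth_body" "prog ! 2 = deg_body" "prog ! 3 = len_body"
  "prog ! 4 = any_body" "prog ! 5 = all_body" "prog ! 6 = app_body" "prog ! 7 = entry_body"
  "prog ! 8 = ins_step_body" "prog ! 9 = ins_body" "prog ! 10 = join_body"
  "prog ! 11 = inner_body" "prog ! 12 = outer_body" "prog ! 13 = leaves_body"
  "prog ! 14 = solve_body" "length prog = 15"
  by (simp_all add: prog_def)

abbreviation enc_nats :: "nat list \<Rightarrow> val" where
  "enc_nats xs \<equiv> enc_list (map Num xs)"

definition adj_matrix :: "nat \<Rightarrow> (nat \<Rightarrow> nat \<Rightarrow> bool) \<Rightarrow> val" where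
  "adj_matrix n adj =
     enc_list (map (\<lambda>i. enc_list (map (\<lambda>j. Num (if adj i j then 1 else 0)) [0..<n])) [0..<n])"

text \<open>The length bounds the loops over \<open>xs\<close>, the range the cost of looking its
  members up in the matrix.\<close>

definition small :: "nat \<Rightarrow> nat list \<Rightarrow> bool" where
  "small n xs \<longleftrightarrow> length xs \<le> n \<and> set xs \<subseteq> {..<n}"

lemma runs_nth:
  "i < length xs \<Longrightarrow> runs prog (Suc 0) [enc_list xs, Num i] (xs ! i) (20 * (i + 1))"
proof (induction xs arbitrary: i)
  case (Cons x xs)
  show ?case
  proof (cases i)
    case 0
    then show ?thesis by (intro runsI) (simp_all add: nth_body_def)
  next
    case (Suc j)
    then have r: "runs prog (Suc 0) [enc_list xs, Num j] (xs ! j) (20 * (j + 1))"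
      using Cons by simp
    show ?thesis using Suc runsD[OF r] by (intro runsI) (simp_all add: nth_body_def)
  qed
qed simp

section \<open>Running time\<close>

text \<open>The outer \<open>+ 10\<close> in the bound of a loop comes from \<open>runs_loop\<close>; the other additive
  constants are generous.\<close>

definition "b_deg n = (2 * (20 * (n + 1)) + 20 + 10) * (n + 1)"
definition "b_len n = (10 + 10) * (n + 1 :: nat)"
definition "b_any n = (b_deg n + b_len n + 30 + 10) * (n + 1)"
definition "b_entry n = 3 * b_any n + 2 * b_len n + 50"

lemma fold_count: "fold (\<lambda>x a. a + (if p x then 1 else 0)) xs a = a + length (filter p xs)"
  by (induction xs arbitrary: a) auto

lemma runs_deg:
  assumes "small n X" "y < n"
  shows "runs prog 2 [enc_nats X, Num a, Cell (adj_matrix n adj) (Num y)]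
    (Num (a + length (filter (\<lambda>x. adj x y) X))) (b_deg n)"
proof -
  \<comment> \<open>An adjacency test is two list accesses, row and then entry; hence the factor 2
    in \<open>b_deg\<close>.\<close>
  have r: "runs prog (Suc 0) [adj_matrix n adj, Num x]
      (enc_list (map (\<lambda>j. Num (if adj x j then 1 else 0)) [0..<n])) (20 * (n + 1))"
    and r': "runs prog (Suc 0) [enc_list (map (\<lambda>j. Num (if adj x j then 1 else 0)) [0..<n]), Num y]
      (Num (if adj x y then 1 else 0)) (20 * (n + 1))" if x: "x < n" for x
  proof -
    let ?row = "\<lambda>i. map (\<lambda>j. Num (if adj i j then 1 else 0)) [0..<n]"
    have "runs prog (Suc 0) [adj_matrix n adj, Num x] (enc_list (?row x)) (20 * (x + 1))"
      using runs_nth[of x "map (\<lambda>i. enc_list (?row i)) [0..<n]"] x by (simp add: adj_matrix_def)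
    then show "runs prog (Suc 0) [adj_matrix n adj, Num x] (enc_list (?row x)) (20 * (n + 1))"
      by (rule runs_mono) (use x in simp)
    have "runs prog (Suc 0) [enc_list (?row x), Num y] (Num (if adj x y then 1 else 0)) (20 * (y + 1))"
      using runs_nth[of y "?row x"] assms(2) by simp
    then show "runs prog (Suc 0) [enc_list (?row x), Num y] (Num (if adj x y then 1 else 0)) (20 * (n + 1))"
      by (rule runs_mono) (use assms(2) in simp)
  qed
  have "runs prog 2 [enc_nats X, Num a, Cell (adj_matrix n adj) (Num y)]
    (Num (fold (\<lambda>x a. a + (if adj x y then 1 else 0)) X a)) ((2 * (20 * (n + 1)) + 20 + 10) * (n + 1))"
  proof (rule runs_loop[where I = "\<lambda>_. True"])
    fix x a r assume "x \<in> set X"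
    then have "x < n" using assms(1) by (auto simp: small_def)
    from runsD[OF r[OF this]] runsD[OF r'[OF this]]
    show "True \<and> val_of prog [Cell (Num x) r, Num a, Cell (adj_matrix n adj) (Num y)]
        (Prim Plus [Var 1, adjE (fstE (Var 2)) (fstE (Var 0)) (sndE (Var 2))])
        = Some (Num (a + (if adj x y then 1 else 0))) \<and>
      time_of prog [Cell (Num x) r, Num a, Cell (adj_matrix n adj) (Num y)]
        (Prim Plus [Var 1, adjE (fstE (Var 2)) (fstE (Var 0)) (sndE (Var 2))]) \<le> 2 * (20 * (n + 1)) + 20"
      by simp
  qed (use assms in \<open>simp_all add: deg_body_def small_def\<close>)
  then show ?thesis by (simp only: fold_count b_deg_def)
qed

lemma runs_len:
  assumes "length X \<le> n"
  shows "runs prog 3 [enc_nats X, Num a, Num 0] (Num (a + length X)) (b_len n)"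
proof -
  \<comment> \<open>Length as counting with a predicate that always holds, to fit
    \<open>fold_count\<close>.\<close>
  have "runs prog 3 [enc_nats X, Num a, Num 0] (Num (fold (\<lambda>x a. a + (if True then 1 else 0)) X a))
    ((10 + 10) * (n + 1))"
    by (rule runs_loop[where I = "\<lambda>_. True", OF _ trans[OF prog_nth(4) len_body_def] _ _ assms])
      simp_all
  then show ?thesis unfolding fold_count by (simp add: b_len_def)
qed

lemma runs_any:
  assumes "small n X" "small n Y"
  shows "runs prog 4 [enc_nats Y, Num 0, Cell (adj_matrix n adj) (enc_nats X)]
    (Num (count_any adj X Y)) (b_any n)"
proof -
  have "runs prog 4 [enc_nats Y, Num 0, Cell (adj_matrix n adj) (enc_nats X)]
    (Num (fold (\<lambda>y a. a + (if \<exists>x\<in>set X. adj x y then 1 else 0)) Y 0))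
    ((b_deg n + b_len n + 30 + 10) * (n + 1))"
  proof (rule runs_loop[where I = "\<lambda>_. True"])
    fix y a r assume "y \<in> set Y"
    then have "y < n" using assms(2) by (auto simp: small_def)
    note d = runsD[OF runs_deg[OF assms(1) this, where a = 0 and adj = adj]]
    have "length (filter (\<lambda>x. adj x y) X) > 0 \<longleftrightarrow> (\<exists>x\<in>set X. adj x y)"
      by (auto simp: filter_empty_conv)
    with d show "True \<and> val_of prog [Cell (Num y) r, Num a, Cell (adj_matrix n adj) (enc_nats X)]
        (Prim Plus [Var 1, Prim Lt [Const 0, degE (fstE (Var 2)) (sndE (Var 2)) (fstE (Var 0))]])
        = Some (Num (a + (if \<exists>x\<in>set X. adj x y then 1 else 0))) \<and>
      time_of prog [Cell (Num y) r, Num a, Cell (adj_matrix n adj) (enc_nats X)]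
        (Prim Plus [Var 1, Prim Lt [Const 0, degE (fstE (Var 2)) (sndE (Var 2)) (fstE (Var 0))]])
        \<le> b_deg n + b_len n + 30"
      by simp
  qed (use assms in \<open>simp_all add: any_body_def small_def\<close>)
  then show ?thesis by (simp only: fold_count b_any_def count_any_def add_0)
qed

lemma runs_all:
  assumes "small n X" "small n Y"
  shows "runs prog 5 [enc_nats Y, Num 0, Cell (adj_matrix n adj) (enc_nats X)]
    (Num (count_all adj X Y)) (b_any n)"
proof -
  have "runs prog 5 [enc_nats Y, Num 0, Cell (adj_matrix n adj) (enc_nats X)]
    (Num (fold (\<lambda>y a. a + (if \<forall>x\<in>set X. adj x y then 1 else 0)) Y 0))
    ((b_deg n + b_len n + 30 + 10) * (n + 1))"
  proof (rule runs_loop[where I = "\<lambda>_. True"])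
    fix y a r assume "y \<in> set Y"
    then have "y < n" using assms(2) by (auto simp: small_def)
    note d = runsD[OF runs_deg[OF assms(1) this, where a = 0 and adj = adj]]
    have "length X \<le> n" using assms(1) by (simp add: small_def)
    note l = runsD[OF runs_len[OF this, where a = 0]]
    have "length (filter (\<lambda>x. adj x y) X) = length X \<longleftrightarrow> (\<forall>x\<in>set X. adj x y)"
      by (metis filter_id_conv length_filter_less less_irrefl)
    with d l show "True \<and> val_of prog [Cell (Num y) r, Num a, Cell (adj_matrix n adj) (enc_nats X)]
        (Prim Plus [Var 1, Prim Eq [degE (fstE (Var 2)) (sndE (Var 2)) (fstE (Var 0)), lenE (sndE (Var 2))]])
        = Some (Num (a + (if \<forall>x\<in>set X. adj x y then 1 else 0))) \<and>
      time_of prog [Cell (Num y) r, Num a, Cell (adj_matrix n adj) (enc_nats X)]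
        (Prim Plus [Var 1, Prim Eq [degE (fstE (Var 2)) (sndE (Var 2)) (fstE (Var 0)), lenE (sndE (Var 2))]])
        \<le> b_deg n + b_len n + 30"
      by simp
  qed (use assms in \<open>simp_all add: all_body_def small_def\<close>)
  then show ?thesis by (simp only: fold_count b_any_def count_all_def add_0)
qed

lemma runs_app:
  assumes "length X \<le> n"
  shows "runs prog 6 [enc_nats X, enc_nats Y, Num 0] (enc_nats (rev X @ Y)) (b_len n)"
proof -
  have "runs prog 6 [enc_nats X, enc_nats Y, Num 0] (enc_nats (fold Cons X Y)) ((10 + 10) * (n + 1))"
    by (rule runs_loop[where I = "\<lambda>_. True", OF _ trans[OF prog_nth(7) app_body_def] _ _ assms])
      simp_all
  then show ?thesis by (simp add: fold_Cons_rev b_len_def)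
qed

fun enc_entry :: "(nat \<Rightarrow> nat \<Rightarrow> bool) \<Rightarrow> nat list \<Rightarrow> nat entry \<Rightarrow> val" where
  "enc_entry adj out (C, R) = Cell (enc_nats C) (Cell (enc_nats R) (Cell (Num (count_any adj R out))
     (Cell (Num (count_any adj C out)) (Cell (Num (count_all adj C out))
       (Num (length C + length R))))))"

lemma runs_entry:
  assumes "small n C" "small n R" "small n out"
  shows "runs prog 7 [enc_nats C, enc_nats R, adj_matrix n adj, enc_nats out]
    (enc_entry adj out (C, R)) (b_entry n)"
proof -
  have "length C \<le> n" "length R \<le> n" using assms by (simp_all add: small_def)
  note l = runsD[OF runs_len[OF this(1), where a = 0]] runsD[OF runs_len[OF this(2), where a = 0]]
  note a = runsD[OF runs_any[OF assms(1,3), of adj]] runsD[OF runs_any[OF assms(2,3), of adj]]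
    runsD[OF runs_all[OF assms(1,3), of adj]]
  show ?thesis using l a by (intro runsI) (simp_all add: entry_body_def b_entry_def)
qed

text \<open>The cube counts the possible keys. The \<open>+ 3\<close> covers leaf tables, whose
  three entries are written down without comparing keys.\<close>

definition "b_table n = (n + 1) ^ 3 + (3 :: nat)"
definition "b_ins_step n = (80 + 10) * (b_table n + 1)"
definition "b_ins n = b_entry n + b_ins_step n + 30"
definition "b_join n = 10 * b_any n + 20 * b_len n + 5 * b_ins n + 300"
definition "b_inner n = (b_join n + 50 + 10) * (b_table n + 1)"
definition "b_outer n = (b_inner n + 30 + 10) * (b_table n + 1)"
text \<open>One bound for both kinds of nodes: two leaf listings and a combination at an inner node,
  three entries at a leaf.\<close>

definition "b_node n = 80 * n + b_outer n + 3 * b_entry n + 100"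
definition "b_main n = b_node n * (2 * n) + b_len n + 50"

abbreviation enc_table :: "(nat \<Rightarrow> nat \<Rightarrow> bool) \<Rightarrow> nat list \<Rightarrow> nat entry list \<Rightarrow> val" where
  "enc_table adj out tbl \<equiv> enc_list (map (enc_entry adj out) tbl)"

lemma poly_bounded_main: "poly_bounded b_main"
  unfolding b_main_def[abs_def] b_node_def b_outer_def b_inner_def b_join_def b_ins_def
    b_ins_step_def b_table_def b_entry_def b_any_def b_len_def b_deg_def
  by (intro poly_bounded_intros)

lemma length_table:
  assumes "distinct (map (key adj out) tbl)" "length out \<le> n"
  shows "length tbl \<le> b_table n"
proof -
  have "key adj out e \<in> {..n} \<times> {..n} \<times> {..n}" for e
    by (cases e) (simp add: count_any_def count_all_def le_trans[OF length_filter_le assms(2)])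
  then have "set (map (key adj out) tbl) \<subseteq> {..n} \<times> {..n} \<times> {..n}" by auto
  then have "card (set (map (key adj out) tbl)) \<le> card ({..n} \<times> {..n} \<times> {..n})"
    by (intro card_mono) auto
  then show ?thesis
    by (simp add: distinct_card[OF assms(1), unfolded length_map] b_table_def power3_eq_cube card_cartesian_product
        algebra_simps del: set_map)
qed

lemma runs_ins_step:
  assumes "length tbl \<le> b_table n"
  shows "runs prog 8 [enc_table adj out tbl, Cell (enc_entry adj out e) (Num 0), Num 0]
    (enc_table adj out (insert_best (key adj out) e tbl)) (b_ins_step n)"
proof -
  let ?body = "LetIn (fstE (Var 0)) (LetIn (fstE (Var 2))
  (Cond (Cond (Prim Eq [keyE1 (Var 1), keyE1 (Var 0)])
      (Cond (Prim Eq [keyE2 (Var 1), keyE2 (Var 0)])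
        (Prim Eq [keyE3 (Var 1), keyE3 (Var 0)]) (Const 0)) (Const 0))
    (consE (Cond (Prim Lt [sizeE (Var 0), sizeE (Var 1)]) (Var 1) (Var 0)) (sndE (Var 3)))
    (consE (Var 0) (consE (Var 1) (sndE (Var 3))))))"
  have "runs prog 8 [enc_table adj out tbl, enc_table adj out [e], Num 0]
    (enc_table adj out (fold (insert_step (key adj out)) tbl [e])) ((80 + 10) * (b_table n + 1))"
  \<comment> \<open>The accumulator starts with the inserted entry and stays nonempty, so its head
    can be projected.\<close>
  proof (rule runs_loop[where I = "\<lambda>a. a \<noteq> []", OF _ trans[OF prog_nth(9) ins_step_body_def] _ _ assms])
    fix f :: "nat entry" and a :: "nat entry list" and r assume "a \<noteq> []"
    then obtain C R tl where a: "a = (C, R) # tl" by (metis list.exhaust surj_pair)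
    obtain C' R' where f: "f = (C', R')" by (cases f)
    show "insert_step (key adj out) f a \<noteq> [] \<and>
      val_of prog [Cell (enc_entry adj out f) r, enc_table adj out a, Num 0] ?body =
        Some (enc_table adj out (insert_step (key adj out) f a)) \<and>
      time_of prog [Cell (enc_entry adj out f) r, enc_table adj out a, Num 0] ?body \<le> 80"
      unfolding a f by simp
  qed simp_all
  then show ?thesis by (simp add: insert_best_def b_ins_step_def)
qed

lemma runs_ins:
  assumes "small n C" "small n R" "small n out" "length tbl \<le> b_table n"
  shows "runs prog 9 [enc_nats C, enc_nats R, enc_table adj out tbl, adj_matrix n adj, enc_nats out]
    (enc_table adj out (insert_best (key adj out) (C, R) tbl)) (b_ins n)"
  using runsD[OF runs_entry[OF assms(1-3), of adj]]
    runsD[OF runs_ins_step[OF assms(4), of adj out "(C, R)"]]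
  by (intro runsI) (simp_all add: ins_body_def b_ins_def del: enc_entry.simps)

lemma runs_join:
  assumes s: "small n (C1 @ R1 @ C2 @ R2)" "small n out"
    and d: "distinct (map (key adj out) tbl)"
  shows "runs prog 10 [enc_nats C1, enc_nats R1, enc_nats C2, enc_nats R2, enc_table adj out tbl,
      adj_matrix n adj, enc_nats out]
    (enc_table adj out (fold (insert_best (key adj out)) (candidates adj (C1, R1) (C2, R2)) tbl)) (b_join n)"
proof -
  define K where "K = key adj out"
  define M where "M = adj_matrix n adj"
  define C R where "C = rev C1 @ C2" and "R = rev R1 @ R2"
  define Q Q1 Q2 where "Q = rev C @ R" and "Q1 = rev C1 @ R" and "Q2 = rev C2 @ R"
  have sm: "small n C1" "small n R1" "small n C2" "small n R2" "small n []"
    "small n C" "small n R" "small n Q" "small n Q1" "small n Q2"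
    using s(1) by (auto simp: small_def C_def R_def Q_def Q1_def Q2_def)
  have len: "length X \<le> n" if "small n X" for X using that by (simp add: small_def)
  note app = runsD[OF runs_app[OF len[OF sm(2)], of R2, folded R_def]]
    runsD[OF runs_app[OF len[OF sm(1)], of C2, folded C_def]]
    runsD[OF runs_app[OF len[OF sm(6)], of R, folded Q_def]]
    runsD[OF runs_app[OF len[OF sm(1)], of R, folded Q1_def]]
    runsD[OF runs_app[OF len[OF sm(3)], of R, folded Q2_def]]
  note any = runsD[OF runs_any[OF sm(2,3), of adj, folded M_def]]
    runsD[OF runs_any[OF sm(2,4), of adj, folded M_def]]
    runsD[OF runs_any[OF sm(1,4), of adj, folded M_def]]
    runsD[OF runs_any[OF sm(1,3), of adj, folded M_def]]
    runsD[OF runs_all[OF sm(1,3), of adj, folded M_def]]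
    runsD[OF runs_len[OF len[OF sm(3)], of 0]]
  have insert_best: "call_val prog 9 [enc_nats X, enc_nats Y, enc_table adj out t, M, enc_nats out] =
      Some (enc_table adj out (insert_best K (X, Y) t)) \<and>
    call_time prog 9 [enc_nats X, enc_nats Y, enc_table adj out t, M, enc_nats out] \<le> b_ins n"
    if "small n X" "small n Y" "distinct (map K t)" for X Y t
    using runsD[OF runs_ins[OF that(1,2) s(2) length_table[OF that(3)[unfolded K_def]]], of adj] len[OF s(2)]
    by (simp add: K_def M_def)
  define full where "full \<longleftrightarrow> count_all adj C1 C2 = length C2"
  define t1 where "t1 = insert_best K ([], Q) tbl"
  define t2 where "t2 = (if full then insert_best K (C, R) t1 else tbl)"
  define t3 where "t3 = insert_best K ([], Q) t2"
  define t4 where "t4 = insert_best K (C1, Q2) t3"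
  define t5 where "t5 = insert_best K (C2, Q1) t4"
  \<comment> \<open>Distinct keys keep every intermediate table within \<open>b_table n\<close>,
    which the cost of the next insertion relies on.\<close>
  have dt: "distinct (map K t1)" "distinct (map K t2)" "distinct (map K t3)" "distinct (map K t4)"
    using d by (auto simp: t1_def t2_def t3_def t4_def K_def intro!: insert_best_correct(1))
  note i = insert_best[OF sm(5,8) d[folded K_def], folded t1_def] insert_best[OF sm(6,7) dt(1)]
    insert_best[OF sm(5,8) dt(2), folded t3_def] insert_best[OF sm(1,10) dt(3), folded t4_def]
    insert_best[OF sm(3,9) dt(4), folded t5_def]
  have res: "fold (insert_best K) (candidates adj (C1, R1) (C2, R2)) tbl =
    (if count_any adj R1 C2 + count_any adj R1 R2 + count_any adj C1 R2 = 0
     then if count_any adj C1 C2 = 0 then t5 else t2 else tbl)"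
    by (simp add: Let_def t1_def t2_def t3_def t4_def t5_def full_def
        C_def[symmetric] R_def[symmetric] Q_def[symmetric] Q1_def[symmetric] Q2_def[symmetric]
        del: rev_append)
  show ?thesis
    unfolding K_def[symmetric] M_def[symmetric] res
    using app any i
    by (intro runsI) (auto simp: join_body_def b_join_def t2_def full_def)
qed

text \<open>The keys stored in the child tables refer to other lists \<open>out1\<close> and
  \<open>out2\<close>. Only the vertex lists of the entries are read; their keys are computed afresh
  for \<open>out\<close>.\<close>

lemma runs_inner:
  assumes "\<forall>(C2, R2)\<in>set T2. small n (C1 @ R1 @ C2 @ R2)" "small n out"
    and "distinct (map (key adj out) tbl)" "length T2 \<le> b_table n"
  shows "runs prog 11 [enc_table adj out2 T2, enc_table adj out tbl,
      Cell (enc_entry adj out1 (C1, R1)) (Cell (adj_matrix n adj) (enc_nats out))]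
    (enc_table adj out (fold (\<lambda>e2. fold (insert_best (key adj out)) (candidates adj (C1, R1) e2)) T2 tbl)) (b_inner n)"
  unfolding b_inner_def
proof (rule runs_loop[where I = "\<lambda>t. distinct (map (key adj out) t)",
      OF _ trans[OF prog_nth(12) inner_body_def] _ assms(3,4)])
  let ?c = "Cell (enc_entry adj out1 (C1, R1)) (Cell (adj_matrix n adj) (enc_nats out))"
  let ?body = "Call 10 [fstE (fstE (Var 2)), fstE (sndE (fstE (Var 2))),
    fstE (fstE (Var 0)), fstE (sndE (fstE (Var 0))), Var 1, fstE (sndE (Var 2)), sndE (sndE (Var 2))]"
  fix e2 a r assume e2: "e2 \<in> set T2" and a: "distinct (map (key adj out) a)"
  obtain C2 R2 where e: "e2 = (C2, R2)" by (cases e2)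
  have "small n (C1 @ R1 @ C2 @ R2)" using assms(1) e2 e by auto
  note j = runsD[OF runs_join[OF this assms(2) a]]
  have "distinct (map (key adj out) (fold (insert_best (key adj out)) (candidates adj (C1, R1) e2) a))"
    by (rule fold_insert_best_correct(1)[OF a])
  moreover have "val_of prog [Cell (enc_entry adj out2 e2) r, enc_table adj out a, ?c] ?body =
      Some (enc_table adj out (fold (insert_best (key adj out)) (candidates adj (C1, R1) e2) a)) \<and>
    time_of prog [Cell (enc_entry adj out2 e2) r, enc_table adj out a, ?c] ?body \<le> b_join n + 50"
    using j by (simp add: e del: candidates.simps)
  ultimately show "distinct (map (key adj out) (fold (insert_best (key adj out)) (candidates adj (C1, R1) e2) a)) \<and>
    val_of prog [Cell (enc_entry adj out2 e2) r, enc_table adj out a, ?c] ?body =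
      Some (enc_table adj out (fold (insert_best (key adj out)) (candidates adj (C1, R1) e2) a)) \<and>
    time_of prog [Cell (enc_entry adj out2 e2) r, enc_table adj out a, ?c] ?body \<le> b_join n + 50"
    by blast
qed simp

lemma runs_outer:
  assumes "\<forall>(C1, R1)\<in>set T1. \<forall>(C2, R2)\<in>set T2. small n (C1 @ R1 @ C2 @ R2)" "small n out"
    and "length T1 \<le> b_table n" "length T2 \<le> b_table n"
  shows "runs prog 12 [enc_table adj out1 T1, Num 0,
      Cell (enc_table adj out2 T2) (Cell (adj_matrix n adj) (enc_nats out))]
    (enc_table adj out (combine adj out T1 T2)) (b_outer n)"
proof -
  let ?c = "Cell (enc_table adj out2 T2) (Cell (adj_matrix n adj) (enc_nats out))"
  let ?body = "Call 11 [fstE (Var 2), Var 1, consE (fstE (Var 0)) (sndE (Var 2))]"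
  let ?g = "\<lambda>e1. fold (\<lambda>e2. fold (insert_best (key adj out)) (candidates adj e1 e2)) T2"
  have "runs prog 12 [enc_table adj out1 T1, enc_table adj out [], ?c]
    (enc_table adj out (fold ?g T1 [])) ((b_inner n + 30 + 10) * (b_table n + 1))"
  proof (rule runs_loop[where I = "\<lambda>t. distinct (map (key adj out) t)",
        OF _ trans[OF prog_nth(13) outer_body_def] _ _ assms(3)])
    fix e1 a r assume e1: "e1 \<in> set T1" and a: "distinct (map (key adj out) a)"
    obtain C1 R1 where e: "e1 = (C1, R1)" by (cases e1)
    have "\<forall>(C2, R2)\<in>set T2. small n (C1 @ R1 @ C2 @ R2)" using assms(1) e1 e by auto
    note j = runsD[OF runs_inner[OF this assms(2) a assms(4), of out2 out1]]
    have "distinct (map (key adj out) (?g e1 a))"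
      unfolding fold_fold by (rule fold_insert_best_correct(1)[OF a])
    moreover have "val_of prog [Cell (enc_entry adj out1 e1) r, enc_table adj out a, ?c] ?body =
        Some (enc_table adj out (?g e1 a)) \<and>
      time_of prog [Cell (enc_entry adj out1 e1) r, enc_table adj out a, ?c] ?body \<le> b_inner n + 30"
      using j by (simp add: e del: candidates.simps enc_entry.simps)
    ultimately show "distinct (map (key adj out) (?g e1 a)) \<and>
      val_of prog [Cell (enc_entry adj out1 e1) r, enc_table adj out a, ?c] ?body =
        Some (enc_table adj out (?g e1 a)) \<and>
      time_of prog [Cell (enc_entry adj out1 e1) r, enc_table adj out a, ?c] ?body \<le> b_inner n + 30"
      by blast
  qed simp_all
  then show ?thesis by (simp add: combine_def b_outer_def)
qed

lemma length_leaves_pos: "0 < length (leaves t)"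
  by (induction t) auto

text \<open>The bound is 20 steps for each of the \<open>2 * k - 1\<close> nodes of a tree with
  \<open>k\<close> leaves.\<close>

lemma runs_leaves:
  "runs prog 13 [enc_layout t, enc_nats xs] (enc_nats (leaves t @ xs)) (40 * length (leaves t) - 20)"
proof (induction t arbitrary: xs)
  case (Leaf v)
  show ?case by (intro runsI) (simp_all add: leaves_body_def)
next
  case (Node l r)
  note i = runsD[OF Node.IH(2)[of xs]] runsD[OF Node.IH(1)[of "leaves r @ xs"]]
  obtain a b where "length (leaves l) = Suc a" "length (leaves r) = Suc b"
    using length_leaves_pos by (metis gr0_conv_Suc)
  then show ?case
    using i by (intro runsI) (simp_all add: leaves_body_def)
qed

lemma distinct_small:
  assumes d: "distinct xs" and s: "set xs \<subseteq> {..<n}"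
  shows "small n xs"
proof -
  have "card (set xs) \<le> card {..<n}" using s by (rule card_mono[OF finite_lessThan])
  then have "length xs \<le> n" by (simp only: distinct_card[OF d] card_lessThan)
  then show ?thesis using s by (simp only: small_def simp_thms)
qed

lemma length_solve:
  assumes "length out \<le> n"
  shows "length (solve adj t out) \<le> b_table n"
proof (cases t)
  case (Node l r)
  then show ?thesis using length_table[OF combine_correct(1) assms] by simp
qed (simp add: b_table_def)

text \<open>The bound has the form \<open>b * (number of tree nodes)\<close>, as a layout with \<open>k\<close> leaves has
  \<open>2 * k - 1\<close> nodes.\<close>

lemma runs_solve:
  assumes "symp adj" "distinct (leaves t @ out)" "set (leaves t @ out) \<subseteq> {..<n}"
  shows "runs prog 14 [enc_layout t, adj_matrix n adj, enc_nats out]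
    (enc_table adj out (solve adj t out)) (b_node n * (2 * length (leaves t)) - b_node n)"
  using assms(2,3)
proof (induction t arbitrary: out)
  case (Leaf v)
  have "small n [v]" "small n []" "small n out"
    using Leaf.prems by (auto intro: distinct_small)
  note e = runsD[OF runs_entry[OF this(1,2,3), of adj]] runsD[OF runs_entry[OF this(2,1,3), of adj]]
    runsD[OF runs_entry[OF this(2,2,3), of adj]]
  show ?case using e by (intro runsI) (simp_all add: solve_body_def b_node_def del: enc_entry.simps)
next
  case (Node l r)
  let ?T1 = "solve adj l (leaves r @ out)" and ?T2 = "solve adj r (leaves l @ out)"
  have so: "small n out" "small n (leaves r @ out)" "small n (leaves l @ out)"
    "small n (leaves l)" "small n (leaves r)"
    using Node.prems by (auto intro!: distinct_small)
  then have len: "length (leaves r @ out) \<le> n" "length (leaves l @ out) \<le> n"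
    "length (leaves l) \<le> n" "length (leaves r) \<le> n" by (simp_all add: small_def)
  \<comment> \<open>Correctness enters the time bound: valid entries of disjoint subtrees are
    together free of repetitions, hence of length at most \<open>n\<close>.\<close>
  have "\<forall>(C1, R1)\<in>set ?T1. \<forall>(C2, R2)\<in>set ?T2. small n (C1 @ R1 @ C2 @ R2)"
  proof (clarify, rule distinct_small)
    fix C1 R1 C2 R2 assume e: "(C1, R1) \<in> set ?T1" "(C2, R2) \<in> set ?T2"
    have "distinct (leaves l)" "distinct (leaves r)" using Node.prems(1) by simp_all
    from solve_valid[OF assms(1) this(1) e(1)] solve_valid[OF assms(1) this(2) e(2)]
    have v: "distinct (C1 @ R1)" "set (C1 @ R1) \<subseteq> set (leaves l)"
      "distinct (C2 @ R2)" "set (C2 @ R2) \<subseteq> set (leaves r)" by simp_all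
    have "set (leaves l) \<inter> set (leaves r) = {}" using Node.prems(1) by auto
    then have "set (C1 @ R1) \<inter> set (C2 @ R2) = {}" using v(2,4) by blast
    then have "distinct ((C1 @ R1) @ (C2 @ R2))" using v(1,3) by (simp only: distinct_append simp_thms)
    then show "distinct (C1 @ R1 @ C2 @ R2)" by simp
    have "set (leaves l) \<subseteq> {..<n}" "set (leaves r) \<subseteq> {..<n}" using Node.prems(2) by simp_all
    then show "set (C1 @ R1 @ C2 @ R2) \<subseteq> {..<n}" using v(2,4) by auto
  qed
  note o = runsD[OF runs_outer[OF this so(1) length_solve[OF len(1)] length_solve[OF len(2)],
      of adj "leaves r @ out" "leaves l @ out"]]
  have "runs prog 14 [enc_layout l, adj_matrix n adj, enc_nats (leaves r @ out)]
    (enc_table adj (leaves r @ out) ?T1) (b_node n * (2 * length (leaves l)) - b_node n)"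
    "runs prog 14 [enc_layout r, adj_matrix n adj, enc_nats (leaves l @ out)]
    (enc_table adj (leaves l @ out) ?T2) (b_node n * (2 * length (leaves r)) - b_node n)"
    using Node.prems by (intro Node.IH; auto)+
  note s = runsD[OF this(1)] runsD[OF this(2)]
  note v = runsD[OF runs_leaves[of r out]] runsD[OF runs_leaves[of l out]]
  define x y z where "x = b_node n * (2 * length (leaves l)) - b_node n"
    and "y = b_node n * (2 * length (leaves r)) - b_node n"
    and "z = b_node n * (2 * length (leaves (Node l r))) - b_node n"
  \<comment> \<open>Rules out truncation in the differences. The children subtract
    \<open>b_node n\<close> twice and the parent once, which leaves one \<open>b_node n\<close> for
    the work at the node itself.\<close>
  have "b_node n \<le> b_node n * (2 * length (leaves l))" "b_node n \<le> b_node n * (2 * length (leaves r))"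
    using length_leaves_pos[of l] length_leaves_pos[of r] by (simp_all add: Suc_leI)
  moreover have "b_node n * (2 * length (leaves (Node l r))) =
      b_node n * (2 * length (leaves l)) + b_node n * (2 * length (leaves r))"
    by (simp add: distrib_left)
  moreover have "80 * n + b_outer n + 100 \<le> b_node n" by (simp add: b_node_def)
  ultimately have "x + y + (80 * n + b_outer n + 100) \<le> z"
    unfolding x_def y_def z_def by linarith
  moreover have "call_time prog 13 [enc_layout r, enc_nats out] \<le> 40 * n"
    "call_time prog 13 [enc_layout l, enc_nats out] \<le> 40 * n"
    using v(2,4) len(3,4) by linarith+
  ultimately show ?case
    using s v(1,3) o unfolding x_def[symmetric] y_def[symmetric] z_def[symmetric]
    by (intro runsI) (simp_all add: solve_body_def)
qed

lemma runs_main: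
  assumes "symp adj" "distinct (leaves t)" "set (leaves t) = {..<n}"
    and "solve adj t [] = (C, R) # tbl" "distinct (C @ R)" "set (C @ R) \<subseteq> {..<n}"
  shows "runs prog 0 [Cell (adj_matrix n adj) (enc_layout t)] (enc_nats (rev C @ R)) (b_main n)"
proof -
  have "length C \<le> n" using distinct_small[OF assms(5,6)] by (simp add: small_def)
  note a = runsD[OF runs_app[OF this, of R]]
  have n: "length (leaves t) = n" using assms(2,3) by (metis card_lessThan distinct_card)
  have "runs prog 14 [enc_layout t, adj_matrix n adj, enc_nats []] (enc_table adj [] ((C, R) # tbl))
    (b_node n * (2 * n) - b_node n)"
    using runs_solve[OF assms(1), of t "[]" n] assms(2-4) n by simp
  note s = runsD[OF this]
  have "call_time prog 14 [enc_layout t, adj_matrix n adj, enc_nats []] \<le> b_node n * (2 * n)"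
    using s(2) by linarith
  then show ?thesis
    using s(1) a by (intro runsI) (simp_all add: main_body_def b_main_def)
qed

theorem theorem7:
  "\<exists>P :: program. solves_in_poly_time P mimw1_instances enc_instance
     (\<lambda>(G, T). card (verts G))
     (\<lambda>(G, T) y. \<exists>S. max_induced_cluster G S \<and> encodes_vertex_set y S)"
proof -
  \<comment> \<open>The \<open>+ 2\<close> pays for the outermost call and its argument.\<close>
  obtain p where p: "\<And>n. b_main n + 2 = poly p n"
    using poly_bounded_intros(3)[OF poly_bounded_main poly_bounded_intros(1)[of 2]]
    unfolding poly_bounded_def by blast
  have "\<exists>y t. eval prog [enc_instance (G, T)] (Call 0 [Var 0]) y t \<and>
      t \<le> poly p (card (verts G)) \<and> (\<exists>S. max_induced_cluster G S \<and> encodes_vertex_set y S)"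
    if "(G, T) \<in> mimw1_instances" for G T
  proof -
    define n where "n = card (verts G)"
    define adj where "adj = (\<lambda>u v. {u, v} \<in> edges G)"
    have GT: "simple_graph G" "verts G = {..<n}" "rooted_layout G T" "mim_width G T \<le> 1"
      using that by (simp_all add: mimw1_instances_def n_def)
    obtain C R tbl where sol: "solve adj T [] = (C, R) # tbl" "distinct (C @ R)"
      "max_induced_cluster G (set (C @ R))"
      using solve_max_induced_cluster[OF GT(1,3,4)] unfolding adj_def by blast
    have "symp adj" by (auto simp: adj_def symp_def insert_commute)
    moreover have "distinct (leaves T)" "set (leaves T) = {..<n}"
      using GT by (auto simp: rooted_layout_def)
    moreover have "set (C @ R) \<subseteq> {..<n}" using sol(3) GT(2) by (simp add: max_induced_cluster_def)
    ultimately have "runs prog 0 [Cell (adj_matrix n adj) (enc_layout T)] (enc_nats (rev C @ R)) (b_main n)"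
      using runs_main sol(1,2) by blast
    moreover have "Cell (adj_matrix n adj) (enc_layout T) = enc_instance (G, T)"
      by (simp add: enc_instance_def enc_graph_def adj_matrix_def adj_def n_def Let_def)
    ultimately have r: "runs prog 0 [enc_instance (G, T)] (enc_nats (rev C @ R)) (b_main n)" by simp
    have "eval prog [enc_instance (G, T)] (Call 0 [Var 0]) (enc_nats (rev C @ R))
        (time_of prog [enc_instance (G, T)] (Call 0 [Var 0]))"
      using runsD(1)[OF r] by (intro eval_val_of(1)) simp
    moreover have "time_of prog [enc_instance (G, T)] (Call 0 [Var 0]) \<le> poly p n"
      using runsD[OF r] by (simp add: p[symmetric])
    moreover have "encodes_vertex_set (enc_nats (rev C @ R)) (set (C @ R))"
      unfolding encodes_vertex_set_def using sol(2) by (intro exI[of _ "rev C @ R"]) auto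
    ultimately show ?thesis using sol(3) unfolding n_def by blast
  qed
  then show ?thesis unfolding solves_in_poly_time_def by (intro exI[of _ prog] exI[of _ p]) auto
qed

end
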